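(* Let $m\ge2$ and let $f_1,\dots,f_m:\mathbb{R}^n\to\mathbb{R}$ be differentiable with $L$-Lipschitz gradients and $\mathbb{E}[f_i(x_k)]\ge F_{\inf}>-\infty$ for all $i\in[m]$ and all iterates $x_k$. Assume that at every iterate $x_k$ and for all $i\in[m]$ $$\nabla f_i(x_k)=\mathbb{E}[\nabla f_i(x_k;\xi)],\qquad \mathbb{E}\|\nabla f_i(x_k;\xi)\|_2^2\le C_f^2,\qquad \mathbb{E}\|\nabla f_i(x_k;\xi)-\nabla f_i(x_k)\|_2^2\le\delta^2,$$ with $C_f>0$, $\delta\ge0$. Let $$M_*^2=(2+\ln m)m^2C_f^4+\left(\tfrac12+\ln m\right)m^2C_f^2\delta^2,\qquad M_2=\left(\frac{2\bar D_{\omega_z,Z}^2S}{S-\lceil rS\rceil+1}+2\sqrt{\frac{S}{\lceil rS\rceil}}\right)\max\{\theta,\theta^{-1}\}M_*.$$ Run the MSMD method (defined in the context) with varying inner step size $\gamma_s=\frac{\theta}{M_*\sqrt s}$ ($s\ge1$), $\theta>0$, fixed outer step size $\alpha_k=\alpha$ with $0<\alpha\le\frac1{4L}$, and $P=\lceil rS\rceil$, $r\in(0,1)$. Let $K\ge4$. (a) If $S=(K+1)^2$, then $$\frac1K\sum_{k=0}^{K-1}\mathbb{E}\|d_k\|_2^2\le O\left(4C_fM_2^{1/2}\frac{1}{\sqrt K}\right).$$ (b) If $S=(k+1)^2$ at outer iteration $k$, then $$\frac1K\sum_{k=0}^{K-1}\mathbb{E}\|d_k\|_2^2\le O\left(8C_fM_2^{1/2}\frac{1}{\sqrt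 K}\right).$$
   Context: $\nabla f_i(x;\xi)$ is a stochastic gradient of $f_i$, $\xi$ a random vector with a fixed distribution supported on $\Xi$. In the assumptions on stochastic gradients, $\mathbb{E}$ is over $\xi$ with $x_k$ held fixed; elsewhere it is total expectation. $[m]=\{1,\dots,m\}$, $\Delta^m=\{\lambda\in\mathbb{R}^m:\lambda\ge0,\sum_i\lambda_i=1\}$, $C=\{d\in\mathbb{R}^n:\|d\|_2\le C_f\}$, $Z=C\times\Delta^m$. "$a_K\le O(b_K)$" means: there is a constant $c>0$ not depending on $K$ (it may depend on the fixed problem and method constants) with $a_K\le c\,b_K$ for all admissible $K$. In (b), where $S$ depends on $k$, $M_2$ is read as the maximum of the displayed expression over $S=(k+1)^2$, $0\le k\le K-1$. Steepest common descent direction at $x_k$: $d_k=\arg\min_{d\in\mathbb{R}^n}\max_{i\in[m]}\nabla f_i(x_k)^Td+\frac12\|d\|_2^2$. Subproblem gradient at $x_k$: for $z=(d,\lambda)\in Z$, $$\nabla\phi_z(z;\xi)=\Big(\sum_{i=1}^m\lambda_i\nabla f_i(x_k;\xi)+d,\ -\big(\langle\nabla f_i(x_k;\xi),d\rangle\big)_{i=1}^m\Big)\in\mathbb{R}^{n}\times\mathbb{R}^m.$$ Bregman data: $\omega_z(d,\lambda)=\frac{1}{2C_f^2}\|d\|_2^2+\frac{1}{2\ln m}\sum_{i=1}^m\lambda_i\ln\lambda_i$ on $Z$ (with $0\ln0=0$), $V(u,v)=\omega_z(v)-\omega_z(u)-\nabla\omega_z(u)^T(v-u)$, prox-mapping $P_z(\zeta)=\arg\min_{u\in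 Z}\{\zeta^T(u-z)+V(z,u)\}$, and $\bar D_{\omega_z,Z}=\sup_{u,v\in Z}\sqrt{2V(u,v)}$. The paper takes $V(u,v)\le\frac12\bar D_{\omega_z,Z}^2<+\infty$ for all $u,v\in Z$. MSMD method (number of inner steps $S$, inner step sizes $\gamma_s$, outer step sizes $\alpha_k$, ratio $r\in(0,1)$, $P=\lceil rS\rceil$): given $x_0\in\mathbb{R}^n$, at outer iteration $k=0,\dots,K-1$ set $d_{k,0}=0$, $\lambda_{k,0}=(1/m,\dots,1/m)$; for $s=0,\dots,S-1$ draw an i.i.d. sample $\xi_s$ (independent of $x_k$ and of all earlier samples) and set $z_{k,s+1}=P_{z_{k,s}}(\gamma_s\nabla\phi_z(z_{k,s};\xi_s))$; then set $z_{k,P}^S=(d_{k,P}^S,\lambda_{k,P}^S)=\big(\sum_{s=P}^S\gamma_s z_{k,s}\big)/\sum_{s=P}^S\gamma_s$ and $x_{k+1}=x_k+\alpha_k d_{k,P}^S$. The step $\gamma_0>0$ is arbitrary.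
   Formalization: The supremum of V over Z×Z is infinite for the entropy term, so the diameter is taken over prox centres u in a set U of points with positive weights and v in Z, V is assumed bounded there, and the inner iterates are assumed to lie almost surely in U. *)

theory Defs
  imports "HOL-Analysis.Analysis" "HOL-Probability.Independent_Family"
begin

text \<open>
  Functions are indexed by a finite type \<open>'m\<close> with \<open>m = CARD('m)\<close>, and \<open>\<real>\<^sup>n\<close> is \<open>real ^ 'n\<close>.
  A primal-dual point \<open>z = (d, \<lambda>)\<close> is a pair; the inner product on pairs is the sum of the two
  componentwise inner products.
\<close>

definition grad :: "('a::real_inner \<Rightarrow> real) \<Rightarrow> 'a \<Rightarrow> 'a" where
  "grad g x = (THE D. GDERIV g x :> D)"

definition steepest_dir :: "('m::finite \<Rightarrow> real^'n \<Rightarrow> real) \<Rightarrow> real^'n \<Rightarrow> real^'n" where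
  "steepest_dir f x =
     arg_min (\<lambda>d. (MAX i\<in>UNIV. grad (f i) x \<bullet> d) + (norm d)\<^sup>2 / 2) (\<lambda>_. True)"


subsection \<open>Bregman data\<close>

definition prob_simplex :: "(real^'m) set" where
  "prob_simplex = {l. (\<forall>i. 0 \<le> l $ i) \<and> (\<Sum>i\<in>UNIV. l $ i) = 1}"

definition Zset :: "real \<Rightarrow> ((real^'n) \<times> (real^'m)) set" where
  "Zset Cf = cball 0 Cf \<times> prob_simplex"

text \<open>
  \<open>\<omega>\<close> is differentiable at the points of \<open>Z\<close> with positive weights only, so that the first argument
  of \<open>V\<close> (the prox centre) has to be taken there. All inner iterates are such points.
\<close>

definition Zint :: "real \<Rightarrow> ((real^'n) \<times> (real^'m)) set" where
  "Zint Cf = {u \<in> Zset Cf. \<forall>i. 0 < snd u $ i}"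

text \<open>Since \<open>ln 0 = 0\<close> in HOL, also \<open>0 * ln 0 = 0\<close>.\<close>

definition omega :: "real \<Rightarrow> (real^'n) \<times> (real^'m) \<Rightarrow> real" where
  "omega Cf z = (norm (fst z))\<^sup>2 / (2 * Cf\<^sup>2)
     + (\<Sum>i\<in>UNIV. snd z $ i * ln (snd z $ i)) / (2 * ln (real CARD('m)))"

definition bregman :: "real \<Rightarrow> (real^'n) \<times> (real^'m) \<Rightarrow> (real^'n) \<times> (real^'m) \<Rightarrow> real" where
  "bregman Cf u v = omega Cf v - omega Cf u - grad (omega Cf) u \<bullet> (v - u)"

definition prox ::
  "real \<Rightarrow> (real^'n) \<times> (real^'m) \<Rightarrow> (real^'n) \<times> (real^'m) \<Rightarrow> (real^'n) \<times> (real^'m)" where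
  "prox Cf z \<zeta> = arg_min (\<lambda>u. \<zeta> \<bullet> (u - z) + bregman Cf z u) (\<lambda>u. u \<in> Zset Cf)"

text \<open>
  The Bregman diameter of \<open>Z\<close>, with the prox centres \<open>u\<close> ranging over a set \<open>U \<subseteq> Zint Cf\<close>. The
  choice \<open>U = Zint Cf\<close> gives the supremum over all pairs for which \<open>V\<close> is defined. That supremum is
  infinite for the entropy: \<open>V(u,v)\<close> contains \<open>(\<Sum>i. v\<^sub>i * ln (v\<^sub>i / u\<^sub>i)) / (2 * ln m)\<close> and is
  unbounded as a weight \<open>u\<^sub>i\<close> tends to \<open>0\<close>. Hence the bound \<open>V(u,v) \<le> D\<^sup>2 / 2 < \<infinity>\<close> for all prox
  centres can only be met on a smaller set \<open>U\<close>, which has to contain the inner iterates.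
\<close>

definition Dbar :: "real \<Rightarrow> ((real^'n) \<times> (real^'m)) set \<Rightarrow> real" where
  "Dbar Cf U = (SUP (u, v) \<in> U \<times> Zset Cf. sqrt (2 * bregman Cf u v))"


subsection \<open>The method\<close>

definition subproblem_grad ::
  "('m::finite \<Rightarrow> real^'n \<Rightarrow> 'xi \<Rightarrow> real^'n) \<Rightarrow> real^'n \<Rightarrow> (real^'n) \<times> (real^'m) \<Rightarrow> 'xi
     \<Rightarrow> (real^'n) \<times> (real^'m)" where
  "subproblem_grad G x z y =
     ((\<Sum>i\<in>UNIV. snd z $ i *\<^sub>R G i x y) + fst z, \<chi> i. - (G i x y \<bullet> fst z))"

primrec inner_iter ::
  "real \<Rightarrow> (nat \<Rightarrow> real) \<Rightarrow> ('m::finite \<Rightarrow> real^'n \<Rightarrow> 'xi \<Rightarrow> real^'n) \<Rightarrow> real^'n \<Rightarrow> (nat \<Rightarrow> 'xi) \<Rightarrow> nat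
     \<Rightarrow> (real^'n) \<times> (real^'m)" where
  "inner_iter Cf \<gamma> G x y 0 = (0, \<chi> i. 1 / real CARD('m))"
| "inner_iter Cf \<gamma> G x y (Suc s) =
     (let z = inner_iter Cf \<gamma> G x y s in prox Cf z (\<gamma> s *\<^sub>R subproblem_grad G x z (y s)))"

definition window_start :: "real \<Rightarrow> nat \<Rightarrow> nat" where
  "window_start r S = nat \<lceil>r * real S\<rceil>"

definition window_avg :: "(nat \<Rightarrow> real) \<Rightarrow> nat \<Rightarrow> nat \<Rightarrow> (nat \<Rightarrow> 'a::real_vector) \<Rightarrow> 'a" where
  "window_avg \<gamma> P S z = (\<Sum>s=P..S. \<gamma> s *\<^sub>R z s) /\<^sub>R (\<Sum>s=P..S. \<gamma> s)"

text \<open>Here \<open>S k\<close> is the number of inner steps and \<open>y k s\<close> the sample drawn at inner step \<open>s\<close>, both at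
  outer iteration \<open>k\<close>.\<close>

primrec msmd ::
  "real \<Rightarrow> (nat \<Rightarrow> real) \<Rightarrow> (nat \<Rightarrow> real) \<Rightarrow> real \<Rightarrow> ('m::finite \<Rightarrow> real^'n \<Rightarrow> 'xi \<Rightarrow> real^'n) \<Rightarrow> real^'n
     \<Rightarrow> (nat \<Rightarrow> nat) \<Rightarrow> (nat \<Rightarrow> nat \<Rightarrow> 'xi) \<Rightarrow> nat \<Rightarrow> real^'n" where
  "msmd Cf \<gamma> \<alpha> r G x0 S y 0 = x0"
| "msmd Cf \<gamma> \<alpha> r G x0 S y (Suc k) =
     (let x = msmd Cf \<gamma> \<alpha> r G x0 S y k
      in x + \<alpha> k *\<^sub>R fst (window_avg \<gamma> (window_start r (S k)) (S k) (inner_iter Cf \<gamma> G x (y k))))"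

text \<open>The step \<open>\<gamma>\<^sub>0\<close> is a free parameter; the formula applies from \<open>s = 1\<close> on.\<close>

definition inner_step :: "real \<Rightarrow> real \<Rightarrow> real \<Rightarrow> nat \<Rightarrow> real" where
  "inner_step \<theta> Mstar \<gamma>0 s = (if s = 0 then \<gamma>0 else \<theta> / (Mstar * sqrt (real s)))"

definition M_star :: "nat \<Rightarrow> real \<Rightarrow> real \<Rightarrow> real" where
  "M_star m Cf \<delta> = sqrt ((2 + ln (real m)) * (real m)\<^sup>2 * Cf ^ 4
                        + (1/2 + ln (real m)) * (real m)\<^sup>2 * Cf\<^sup>2 * \<delta>\<^sup>2)"

definition M_two :: "real \<Rightarrow> real \<Rightarrow> real \<Rightarrow> real \<Rightarrow> nat \<Rightarrow> real" where
  "M_two D \<theta> Mstar r S =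
     (2 * D\<^sup>2 * real S / (real S - real (window_start r S) + 1)
        + 2 * sqrt (real S / real (window_start r S))) * max \<theta> (1 / \<theta>) * Mstar"


subsection \<open>Assumptions along a run\<close>

text \<open>
  \<open>X k\<close> is the outer iterate as a random variable on \<open>M\<close>; \<open>Xi\<close> is the distribution of a single
  sample. The inner integrals are over \<open>Xi\<close> with the value of \<open>X k\<close> held fixed. The second moments
  are nonnegative integrals, so that the bounds include their finiteness.
\<close>

definition oracle_at ::
  "('m::finite \<Rightarrow> real^'n \<Rightarrow> real) \<Rightarrow> ('m \<Rightarrow> real^'n \<Rightarrow> 'xi \<Rightarrow> real^'n) \<Rightarrow> 'xi measure \<Rightarrow> real \<Rightarrow> real
     \<Rightarrow> real^'n \<Rightarrow> bool" where
  "oracle_at f G Xi Cf \<delta> x \<longleftrightarrow>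
     (\<forall>i. has_bochner_integral Xi (G i x) (grad (f i) x)
        \<and> (\<integral>\<^sup>+y. ennreal ((norm (G i x y))\<^sup>2) \<partial>Xi) \<le> ennreal (Cf\<^sup>2)
        \<and> (\<integral>\<^sup>+y. ennreal ((norm (G i x y - grad (f i) x))\<^sup>2) \<partial>Xi) \<le> ennreal (\<delta>\<^sup>2))"

definition run_assms ::
  "'w measure \<Rightarrow> 'xi measure \<Rightarrow> ('m::finite \<Rightarrow> real^'n \<Rightarrow> real) \<Rightarrow> ('m \<Rightarrow> real^'n \<Rightarrow> 'xi \<Rightarrow> real^'n)
     \<Rightarrow> real \<Rightarrow> real \<Rightarrow> real \<Rightarrow> nat \<Rightarrow> (nat \<Rightarrow> 'w \<Rightarrow> real^'n) \<Rightarrow> bool" where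
  "run_assms M Xi f G F_inf Cf \<delta> K X \<longleftrightarrow>
     (\<forall>k\<le>K. \<forall>i. (\<integral>\<omega>. f i (X k \<omega>) \<partial>M) \<ge> F_inf)
   \<and> (\<forall>k<K. AE \<omega> in M. oracle_at f G Xi Cf \<delta> (X k \<omega>))"

text \<open>All inner iterates of the first \<open>K\<close> outer iterations lie in \<open>U\<close>; see \<open>Dbar\<close>. For
  \<open>U = Zint Cf\<close> this is no restriction.\<close>

definition prox_centres_in ::
  "((real^'n) \<times> (real^'m)) set \<Rightarrow> 'w measure \<Rightarrow> real \<Rightarrow> (nat \<Rightarrow> real)
     \<Rightarrow> ('m::finite \<Rightarrow> real^'n \<Rightarrow> 'xi \<Rightarrow> real^'n) \<Rightarrow> (nat \<Rightarrow> nat) \<Rightarrow> (nat \<Rightarrow> nat \<Rightarrow> 'w \<Rightarrow> 'xi) \<Rightarrow> nat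
     \<Rightarrow> (nat \<Rightarrow> 'w \<Rightarrow> real^'n) \<Rightarrow> bool" where
  "prox_centres_in U M Cf \<gamma> G S \<xi> K X \<longleftrightarrow>
     (\<forall>k<K. AE \<omega> in M. \<forall>s\<le>S k. inner_iter Cf \<gamma> G (X k \<omega>) (\<lambda>s. \<xi> k s \<omega>) s \<in> U)"

definition avg_sq_dir ::
  "'w measure \<Rightarrow> ('m::finite \<Rightarrow> real^'n \<Rightarrow> real) \<Rightarrow> nat \<Rightarrow> (nat \<Rightarrow> 'w \<Rightarrow> real^'n) \<Rightarrow> real" where
  "avg_sq_dir M f K X = (1 / real K) * (\<Sum>k<K. \<integral>\<omega>. (norm (steepest_dir f (X k \<omega>)))\<^sup>2 \<partial>M)"

end

theory Submission
  imports Defs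
begin

text \<open>
  Fix one objective \<open>f\<^sub>i\<close>. The subproblem at \<open>x\<^sub>k\<close> is a saddle problem whose value is
  \<open>- \<parallel>d\<^sub>k\<parallel>\<^sup>2 / 2\<close>, and comparing the mirror descent iterates with the point \<open>(d\<^sub>k, e\<^sub>i)\<close> bounds
  \<open>\<nabla>f\<^sub>i(x\<^sub>k)\<^sup>T d + \<parallel>d\<parallel>\<^sup>2 / 2 + \<parallel>d\<^sub>k\<parallel>\<^sup>2 / 2\<close> at the averaged direction \<open>d\<close>. This point is a function of \<open>x\<^sub>k\<close>
  alone, so the gradient noise has mean zero against it and the expected gap of \<open>S\<close> inner steps is
  \<open>O(1 / \<surd>S)\<close>. Since \<open>\<alpha> \<le> 1 / (4L)\<close>, the descent lemma turns this into
  \<open>\<alpha>/2 E\<parallel>d\<^sub>k\<parallel>\<^sup>2 \<le> E f\<^sub>i(x\<^sub>k) - E f\<^sub>i(x\<^sub>k\<^sub>+\<^sub>1) + O(1 / \<surd>S)\<close>. Both schedules satisfy \<open>S \<ge> (k + 1)\<^sup>2\<close> for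
  \<open>k < K\<close>, and \<open>\<Sum>\<^sub>k 1 / (k + 1) \<le> 2 \<surd>K\<close>. The factor \<open>M\<^sub>2\<close> is bounded below by \<open>2 M\<^sub>*\<close>, so it is
  absorbed into the constant.
\<close>

subsection \<open>Gradients and the descent lemma\<close>

text \<open>Fixing \<open>i\<close> in advance matters: a maximising index for the averaged
  direction would depend on the samples and correlate with the noise, whereas the descent lemma for
  a single objective needs only the vertex \<open>axis i 1\<close>. The main obstacle is that
  \<open>prox\<close> and \<open>steepest_dir\<close> are \<open>arg_min\<close> choices, for which
  existence, uniqueness and measurability have to be earned. The prox-mapping receives a closed form
  (a projection and a softmax), and the common descent direction is shown to be continuous in the
  gradients by strong convexity. The ball in \<open>Zset\<close> bounds every iterate
  deterministically, so continuous functions of the iterates are integrable; the samples of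
  \<open>G\<close> are controlled by second moments. Only independence of \<open>K\<close> is asked
  of the constants, so one Euclidean norm serves both blocks, with a cruder noise bound than
  \<open>M_star\<close>. Averaging from the ceiling of \<open>r * S\<close> on keeps the sum of
  squared steps bounded where a full average would cost a logarithm, and the Bregman bound is then
  called for only at the first iterate of the window.\<close>

lemma grad_eqI:
  assumes "GDERIV g x :> D"
  shows "grad g x = D"
  unfolding grad_def
proof (rule the_equality)
  show "GDERIV g x :> D" by fact
next
  fix E assume "GDERIV g x :> E"
  then have "(\<lambda>h. h \<bullet> E) = (\<lambda>h. h \<bullet> D)"
    using assms has_derivative_unique unfolding gderiv_def by blast
  then show "E = D"
    by (metis vector_eq_ldot)
qed

text \<open>The Riesz representer of the derivative is its adjoint applied to 1; this existence,
  together with \<open>grad_eqI\<close>, gives the \<open>THE\<close> in \<open>grad\<close> its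
  meaning.\<close>

lemma GDERIV_grad:
  fixes g :: "'a::euclidean_space \<Rightarrow> real"
  assumes "g differentiable (at x)"
  shows "GDERIV g x :> grad g x"
proof -
  obtain g' where g': "(g has_derivative g') (at x)"
    using assms by (auto simp: differentiable_def)
  have "g' = (\<lambda>h. h \<bullet> adjoint g' 1)"
    using adjoint_works[OF has_derivative_linear[OF g'], of _ 1] by (auto simp: inner_real_def)
  then have "GDERIV g x :> adjoint g' 1"
    using g' by (simp add: gderiv_def)
  then show ?thesis
    using grad_eqI by metis
qed

text \<open>The mean value theorem at one intermediate point gives the constant \<open>L\<close>
  instead of the sharp \<open>L / 2\<close>; the bound \<alpha> \<le> 1 / (4 L) can afford the
  loss.\<close>

lemma descent:
  fixes g :: "'a::euclidean_space \<Rightarrow> real"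
  assumes diff: "\<And>x. g differentiable (at x)" and lip: "L-lipschitz_on UNIV (grad g)"
  shows "g (x + v) \<le> g x + grad g x \<bullet> v + L * (norm v)\<^sup>2"
proof -
  have der: "((\<lambda>t. g (x + t *\<^sub>R v)) has_real_derivative grad g (x + t *\<^sub>R v) \<bullet> v) (at t)" for t
  proof -
    have "(g has_derivative (\<lambda>h. h \<bullet> grad g (x + t *\<^sub>R v))) (at (x + t *\<^sub>R v))"
      using GDERIV_grad[OF diff] by (simp add: gderiv_def)
    moreover have "((\<lambda>t. x + t *\<^sub>R v) has_derivative (\<lambda>h. h *\<^sub>R v)) (at t)"
      by (auto intro!: derivative_eq_intros)
    ultimately have "((\<lambda>t. g (x + t *\<^sub>R v)) has_derivative
        (\<lambda>h. (h *\<^sub>R v) \<bullet> grad g (x + t *\<^sub>R v))) (at t)"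
      using has_derivative_compose by blast
    then show ?thesis
      by (simp add: has_field_derivative_def inner_commute mult.commute[of _ "_ \<bullet> _"])
  qed
  obtain t where t: "0 < t" "t < 1"
      "g (x + 1 *\<^sub>R v) - g (x + 0 *\<^sub>R v) = (1 - 0) * (grad g (x + t *\<^sub>R v) \<bullet> v)"
    using MVT2[of 0 1 "\<lambda>t. g (x + t *\<^sub>R v)" "\<lambda>t. grad g (x + t *\<^sub>R v) \<bullet> v"] der by auto
  have L: "0 \<le> L"
    using lip by (rule lipschitz_on_nonneg)
  have "(grad g (x + t *\<^sub>R v) - grad g x) \<bullet> v \<le> norm (grad g (x + t *\<^sub>R v) - grad g x) * norm v"
    by (rule norm_cauchy_schwarz)
  also have "\<dots> \<le> (L * norm v) * norm v"
  proof (rule mult_right_mono)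
    have "norm (grad g (x + t *\<^sub>R v) - grad g x) \<le> L * norm (t *\<^sub>R v)"
      using lipschitz_onD[OF lip, of "x + t *\<^sub>R v" x] by (simp add: dist_norm)
    also have "\<dots> \<le> L * norm v"
      using t L by (intro mult_left_mono) (auto simp: mult_left_le_one_le)
    finally show "norm (grad g (x + t *\<^sub>R v) - grad g x) \<le> L * norm v" .
  qed simp
  finally show ?thesis
    using t(3) by (simp add: inner_diff_left power2_eq_square)
qed

subsection \<open>The Bregman distance\<close>

text \<open>The derivative is taken in the whole space and not along the simplex, hence the 1 beside
  the logarithm.\<close>

lemma grad_omega:
  fixes u :: "(real^'n) \<times> (real^'m)"
  assumes "\<And>i. 0 < snd u $ i"
  shows "grad (omega Cf) u =
    (fst u /\<^sub>R Cf\<^sup>2, \<chi> i. (1 + ln (snd u $ i)) / (2 * ln (real CARD('m))))"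
proof (rule grad_eqI)
  have ent: "((\<lambda>z. snd z $ i * ln (snd z $ i)) has_derivative
      (\<lambda>h. snd h $ i * (1 + ln (snd u $ i)))) (at u)" for i
  proof -
    have c: "((\<lambda>z. snd z $ i) has_derivative (\<lambda>h. snd h $ i)) (at u)"
      by (intro bounded_linear.has_derivative[OF bounded_linear_vec_nth] has_derivative_snd
          has_derivative_ident)
    have "((\<lambda>z. snd z $ i * ln (snd z $ i)) has_derivative
      (\<lambda>h. snd u $ i * (snd h $ i * inverse (snd u $ i)) + snd h $ i * ln (snd u $ i))) (at u)"
      using assms[of i] by (intro has_derivative_mult c has_derivative_ln) (auto simp: divide_inverse)
    then show ?thesis
      using assms[of i] by (simp add: field_simps less_imp_neq[symmetric])
  qed
  have quad: "((\<lambda>z. (norm (fst z))\<^sup>2) has_derivative (\<lambda>h. 2 * (fst h \<bullet> fst u))) (at u)"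
    unfolding power2_norm_eq_inner
    by (auto intro!: derivative_eq_intros simp: inner_commute)
  have "((\<lambda>z. \<Sum>i\<in>UNIV. snd z $ i * ln (snd z $ i)) has_derivative
        (\<lambda>h. \<Sum>i\<in>UNIV. snd h $ i * (1 + ln (snd u $ i)))) (at u)"
    by (rule has_derivative_sum) (rule ent)
  then have "((\<lambda>z. (\<Sum>i\<in>UNIV. snd z $ i * ln (snd z $ i)) * inverse (2 * ln (real CARD('m))))
      has_derivative
        (\<lambda>h. (\<Sum>i\<in>UNIV. snd h $ i * (1 + ln (snd u $ i))) * inverse (2 * ln (real CARD('m)))))
      (at u)"
    by (rule has_derivative_mult_left)
  moreover have "((\<lambda>z. (norm (fst z))\<^sup>2 * inverse (2 * Cf\<^sup>2)) has_derivative
        (\<lambda>h. 2 * (fst h \<bullet> fst u) * inverse (2 * Cf\<^sup>2))) (at u)"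
    using quad by (rule has_derivative_mult_left)
  ultimately have "((\<lambda>z. (norm (fst z))\<^sup>2 * inverse (2 * Cf\<^sup>2) +
          (\<Sum>i\<in>UNIV. snd z $ i * ln (snd z $ i)) * inverse (2 * ln (real CARD('m)))) has_derivative
        (\<lambda>h. 2 * (fst h \<bullet> fst u) * inverse (2 * Cf\<^sup>2) +
          (\<Sum>i\<in>UNIV. snd h $ i * (1 + ln (snd u $ i))) * inverse (2 * ln (real CARD('m))))) (at u)"
    by (intro has_derivative_add)
  moreover have "(\<lambda>h. 2 * (fst h \<bullet> fst u) * inverse (2 * Cf\<^sup>2) +
          (\<Sum>i\<in>UNIV. snd h $ i * (1 + ln (snd u $ i))) * inverse (2 * ln (real CARD('m)))) =
     (\<lambda>h. h \<bullet> (fst u /\<^sub>R Cf\<^sup>2, \<chi> i. (1 + ln (snd u $ i)) / (2 * ln (real CARD('m)))))"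
  proof (rule ext)
    fix h :: "(real^'n) \<times> (real^'m)"
    have "2 * (fst h \<bullet> fst u) * inverse (2 * Cf\<^sup>2) = fst h \<bullet> (fst u /\<^sub>R Cf\<^sup>2)"
      by simp
    moreover have "(\<Sum>i\<in>UNIV. snd h $ i * (1 + ln (snd u $ i))) * inverse (2 * ln (real CARD('m)))
        = snd h \<bullet> (\<chi> i. (1 + ln (snd u $ i)) / (2 * ln (real CARD('m))))"
      unfolding inner_vec_def sum_distrib_right
      by (rule sum.cong) (simp_all only: vec_lambda_beta inner_real_def divide_inverse mult.assoc)
    ultimately show "2 * (fst h \<bullet> fst u) * inverse (2 * Cf\<^sup>2) +
        (\<Sum>i\<in>UNIV. snd h $ i * (1 + ln (snd u $ i))) * inverse (2 * ln (real CARD('m)))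
      = h \<bullet> (fst u /\<^sub>R Cf\<^sup>2, \<chi> i. (1 + ln (snd u $ i)) / (2 * ln (real CARD('m))))"
      by (simp only: inner_prod_def fst_conv snd_conv)
  qed
  moreover have "(\<lambda>z. (norm (fst z))\<^sup>2 * inverse (2 * Cf\<^sup>2) +
          (\<Sum>i\<in>UNIV. snd z $ i * ln (snd z $ i)) * inverse (2 * ln (real CARD('m)))) =
      (omega Cf :: (real^'n) \<times> (real^'m) \<Rightarrow> real)"
    by (rule ext) (simp only: omega_def divide_inverse)
  ultimately show "GDERIV (omega Cf) u :>
     (fst u /\<^sub>R Cf\<^sup>2, \<chi> i. (1 + ln (snd u $ i)) / (2 * ln (real CARD('m))))"
    by (simp add: gderiv_def)
qed

text \<open>The weight part is the Kullback-Leibler divergence. Its linear terms would cancel in the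
  sum over the simplex, but they are kept because they make each summand nonnegative, which permits
  a termwise lower bound.\<close>

lemma bregman_eq:
  fixes u v :: "(real^'n) \<times> (real^'m)"
  assumes "\<And>i. 0 < snd u $ i"
  shows "bregman Cf u v = (norm (fst v - fst u))\<^sup>2 / (2 * Cf\<^sup>2) +
    (\<Sum>i\<in>UNIV. snd v $ i * ln (snd v $ i) - snd v $ i * ln (snd u $ i) - snd v $ i + snd u $ i)
      / (2 * ln (real CARD('m)))"
proof -
  let ?c = "2 * ln (real CARD('m))"
  have frac: "a / (2 * q) - b / (2 * q) - inverse q * t = (a - b - 2 * t) / (2 * q)"
    for a b q t :: real
    by (cases "q = 0") (auto simp: field_simps)
  have "(norm (fst v))\<^sup>2 / (2 * Cf\<^sup>2) - (norm (fst u))\<^sup>2 / (2 * Cf\<^sup>2)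
      - (fst u /\<^sub>R Cf\<^sup>2) \<bullet> (fst v - fst u)
     = ((norm (fst v))\<^sup>2 - (norm (fst u))\<^sup>2 - 2 * (fst u \<bullet> (fst v - fst u))) / (2 * Cf\<^sup>2)"
    by (simp only: inner_scaleR_left frac)
  also have "(norm (fst v))\<^sup>2 - (norm (fst u))\<^sup>2 - 2 * (fst u \<bullet> (fst v - fst u))
      = (norm (fst v - fst u))\<^sup>2"
    by (simp add: power2_norm_eq_inner inner_diff_left inner_diff_right inner_commute)
  finally have dpart: "(norm (fst v))\<^sup>2 / (2 * Cf\<^sup>2) - (norm (fst u))\<^sup>2 / (2 * Cf\<^sup>2)
      - (fst u /\<^sub>R Cf\<^sup>2) \<bullet> (fst v - fst u) = (norm (fst v - fst u))\<^sup>2 / (2 * Cf\<^sup>2)" .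
  have summand: "a / ?c - b / ?c - e / ?c * t = (a - b - e * t) / ?c" for a b e t :: real
    by (simp add: diff_divide_distrib)
  have lpart: "(\<Sum>i\<in>UNIV. snd v $ i * ln (snd v $ i)) / ?c
      - (\<Sum>i\<in>UNIV. snd u $ i * ln (snd u $ i)) / ?c
      - (\<chi> i. (1 + ln (snd u $ i)) / ?c) \<bullet> (snd v - snd u)
     = (\<Sum>i\<in>UNIV. snd v $ i * ln (snd v $ i) - snd v $ i * ln (snd u $ i)
          - snd v $ i + snd u $ i) / ?c"
    unfolding inner_vec_def sum_divide_distrib sum_subtractf[symmetric] vec_lambda_beta
      inner_real_def summand
    by (intro sum.cong refl arg_cong2[where f = "(/)"]) (simp add: algebra_simps)
  show ?thesis
    unfolding bregman_def grad_omega[OF assms] omega_def inner_prod_def fst_conv snd_conv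
      fst_diff snd_diff
    using dpart lpart by linarith
qed

text \<open>From \<open>ln t \<le> t - 1\<close> at \<open>t = \<surd>(u/v)\<close>, the left-hand side is at least
  \<open>(\<surd>v - \<surd>u)\<^sup>2\<close>.\<close>

lemma entropy_quadratic_lower:
  fixes u v :: real
  assumes u: "0 < u" "u \<le> 1" and v: "0 \<le> v" "v \<le> 1"
  shows "(v - u)\<^sup>2 / 4 \<le> v * ln v - v * ln u - v + u"
proof -
  have hell: "(sqrt v - sqrt u)\<^sup>2 \<le> v * ln v - v * ln u - v + u"
  proof (cases "v = 0")
    case True
    then show ?thesis using u by simp
  next
    case False
    then have v0: "0 < v" using v by simp
    have "ln (sqrt (u / v)) \<le> sqrt (u / v) - 1"
      using u v0 by (intro ln_le_minus_one) simp
    moreover have "ln (sqrt (u / v)) = (ln u - ln v) / 2"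
      using u v0 by (simp add: ln_sqrt ln_div)
    ultimately have "v * (ln u - ln v) \<le> v * (2 * sqrt (u / v) - 2)"
      using v0 by (intro mult_left_mono) auto
    moreover have "v * sqrt (u / v) = sqrt u * sqrt v"
      using v0 by (simp add: real_sqrt_divide field_simps)
    ultimately show ?thesis
      using u v0 by (simp add: power2_diff algebra_simps)
  qed
  \<comment> \<open>Factoring through square roots turns the Hellinger bound into a quadratic one;
    the second factor is at most 4, whence the divisor 4.\<close>
  have "(v - u)\<^sup>2 = (sqrt v - sqrt u)\<^sup>2 * (sqrt v + sqrt u)\<^sup>2"
    using u v by (simp add: power_mult_distrib[symmetric] algebra_simps)
  also have "\<dots> \<le> (sqrt v - sqrt u)\<^sup>2 * 2\<^sup>2"
  proof (intro mult_left_mono power_mono)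
    show "sqrt v + sqrt u \<le> 2"
      using real_sqrt_le_1_iff u v by (smt (verit))
  qed (use u v in auto)
  finally show ?thesis
    using hell by simp
qed

text \<open>The first entry is the coefficient of the quadratic part of \<open>omega\<close>; the
  second is 1/4 from \<open>entropy_quadratic_lower\<close> times the entropy factor 1 / (2 ln m).
  No factor 1/2 is split off, so \<open>kappa\<close> is half a modulus of strong convexity.\<close>

definition kappa :: "real \<Rightarrow> nat \<Rightarrow> real" where
  "kappa Cf m = min (1 / (2 * Cf\<^sup>2)) (1 / (8 * ln (real m)))"

lemma kappa_pos: "0 < Cf \<Longrightarrow> 2 \<le> m \<Longrightarrow> 0 < kappa Cf m"
  by (simp add: kappa_def)

lemma norm_prod_sq: "(norm z)\<^sup>2 = (norm (fst z))\<^sup>2 + (norm (snd z))\<^sup>2"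
  by (simp add: norm_prod_def)

lemma norm_vec_sq: "(norm (x :: real^'m))\<^sup>2 = (\<Sum>i\<in>UNIV. (x $ i)\<^sup>2)"
  by (simp add: norm_vec_def L2_set_def sum_nonneg)

lemma Zset_iff:
  "z \<in> Zset Cf \<longleftrightarrow> norm (fst z) \<le> Cf \<and> (\<forall>i. 0 \<le> snd z $ i) \<and> (\<Sum>i\<in>UNIV. snd z $ i) = 1"
  by (cases z) (auto simp: Zset_def prob_simplex_def)

lemma Zset_weight_le_1: "z \<in> Zset Cf \<Longrightarrow> snd z $ i \<le> 1"
  using member_le_sum[of i UNIV "\<lambda>i. snd z $ i"] by (auto simp: Zset_iff)

lemma Zint_iff: "z \<in> Zint Cf \<longleftrightarrow> z \<in> Zset Cf \<and> (\<forall>i. 0 < snd z $ i)"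
  by (simp add: Zint_def)

lemma bregman_lower:
  fixes u v :: "(real^'n) \<times> (real^'m)"
  assumes m: "2 \<le> CARD('m)" and "0 < Cf" and u: "u \<in> Zint Cf" and v: "v \<in> Zset Cf"
  shows "kappa Cf CARD('m) * (norm (v - u))\<^sup>2 \<le> bregman Cf u v"
proof -
  let ?c = "2 * ln (real CARD('m))"
  have c: "0 < ?c" using m by simp
  have "(norm (snd v - snd u))\<^sup>2 / 4 = (\<Sum>i\<in>UNIV. (snd v $ i - snd u $ i)\<^sup>2 / 4)"
    by (simp add: norm_vec_sq sum_divide_distrib)
  also have "\<dots> \<le> (\<Sum>i\<in>UNIV. snd v $ i * ln (snd v $ i) - snd v $ i * ln (snd u $ i)
      - snd v $ i + snd u $ i)"
    using u v by (intro sum_mono entropy_quadratic_lower)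
      (auto simp: Zint_iff Zset_weight_le_1, auto simp: Zset_iff)
  finally have "(norm (snd v - snd u))\<^sup>2 / 4 / ?c \<le> (\<Sum>i\<in>UNIV. snd v $ i * ln (snd v $ i)
      - snd v $ i * ln (snd u $ i) - snd v $ i + snd u $ i) / ?c"
    using c by (intro divide_right_mono) auto
  moreover have "kappa Cf CARD('m) * (norm (snd v - snd u))\<^sup>2 \<le> (norm (snd v - snd u))\<^sup>2 / 4 / ?c"
    using mult_right_mono[of "kappa Cf CARD('m)" "1 / (8 * ln (real CARD('m)))"
        "(norm (snd v - snd u))\<^sup>2"] by (simp add: kappa_def)
  moreover have "kappa Cf CARD('m) * (norm (fst v - fst u))\<^sup>2 \<le> (norm (fst v - fst u))\<^sup>2 / (2 * Cf\<^sup>2)"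
    using mult_right_mono[of "kappa Cf CARD('m)" "1 / (2 * Cf\<^sup>2)"
        "(norm (fst v - fst u))\<^sup>2"] by (simp add: kappa_def)
  moreover have "kappa Cf CARD('m) * (norm (v - u))\<^sup>2 =
      kappa Cf CARD('m) * (norm (fst v - fst u))\<^sup>2 + kappa Cf CARD('m) * (norm (snd v - snd u))\<^sup>2"
    by (simp only: norm_prod_sq[of "v - u"] fst_diff snd_diff distrib_left)
  ultimately have "kappa Cf CARD('m) * (norm (v - u))\<^sup>2
      \<le> (norm (fst v - fst u))\<^sup>2 / (2 * Cf\<^sup>2) + (\<Sum>i\<in>UNIV. snd v $ i * ln (snd v $ i)
        - snd v $ i * ln (snd u $ i) - snd v $ i + snd u $ i) / ?c"
    by linarith
  also have "\<dots> = bregman Cf u v"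
    using u by (intro bregman_eq[symmetric]) (simp add: Zint_iff)
  finally show ?thesis .
qed

text \<open>Pure algebra, valid for whatever values \<open>grad\<close> takes. It yields both the
  uniqueness of the prox minimiser and the mirror descent inequality.\<close>

lemma bregman_three_point:
  "bregman Cf z u - bregman Cf w u - bregman Cf z w =
    (grad (omega Cf) w - grad (omega Cf) z) \<bullet> (u - w)"
  by (simp add: bregman_def inner_diff_left inner_diff_right algebra_simps)

subsection \<open>The prox-mapping\<close>

text \<open>The ball and the simplex decouple. On the ball the minimiser is a projected gradient
  step, of length \<open>Cf\<^sup>2\<close> since the quadratic is divided by it; on the simplex it
  is a multiplicative-weights update, whose rate 2 ln m undoes the scaling of the entropy. In this
  form measurability and positivity of the weights are visible.\<close>

definition prox_explicit ::
  "real \<Rightarrow> (real^'n) \<times> (real^'m) \<Rightarrow> (real^'n) \<times> (real^'m) \<Rightarrow> (real^'n) \<times> (real^'m)" where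
  "prox_explicit Cf z \<zeta> =
    (closest_point (cball 0 Cf) (fst z - Cf\<^sup>2 *\<^sub>R fst \<zeta>),
     \<chi> i. snd z $ i * exp (- (2 * ln (real CARD('m)) * snd \<zeta> $ i)) /
       (\<Sum>j\<in>UNIV. snd z $ j * exp (- (2 * ln (real CARD('m)) * snd \<zeta> $ j))))"

lemma prox_explicit_Zint:
  fixes z \<zeta> :: "(real^'n) \<times> (real^'m)"
  assumes "0 < Cf" "z \<in> Zint Cf"
  shows "prox_explicit Cf z \<zeta> \<in> Zint Cf"
proof -
  have "0 < (\<Sum>j\<in>UNIV. snd z $ j * exp (- (2 * ln (real CARD('m)) * snd \<zeta> $ j)))"
    using assms by (intro sum_pos) (auto simp: Zint_iff)
  moreover have "closest_point (cball 0 Cf) (fst z - Cf\<^sup>2 *\<^sub>R fst \<zeta>) \<in> cball 0 Cf"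
    using assms by (intro closest_point_in_set) auto
  ultimately show ?thesis
    using assms by (auto simp: Zint_iff Zset_iff prox_explicit_def sum_divide_distrib[symmetric]
        intro!: divide_nonneg_pos less_imp_le)
qed

text \<open>First-order optimality of the closed form. In the weight block the vector is constant,
  the logarithm of the normaliser over 2 ln m up to sign, and hence orthogonal to a difference of
  two points of the simplex. In the direction block it is the obtuse-angle property of the
  projection.\<close>

lemma prox_explicit_variational:
  fixes z \<zeta> u :: "(real^'n) \<times> (real^'m)"
  assumes m: "2 \<le> CARD('m)" and Cf: "0 < Cf" and z: "z \<in> Zint Cf" and u: "u \<in> Zset Cf"
  defines "w \<equiv> prox_explicit Cf z \<zeta>"
  shows "0 \<le> (\<zeta> + (grad (omega Cf) w - grad (omega Cf) z)) \<bullet> (u - w)"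
proof -
  let ?c = "2 * ln (real CARD('m))"
  let ?e = "\<lambda>i. exp (- (?c * snd \<zeta> $ i))"
  define s where "s = (\<Sum>j\<in>UNIV. snd z $ j * ?e j)"
  have c: "0 < ?c" using m by simp
  have zpos: "0 < snd z $ i" for i using z by (simp add: Zint_iff)
  have s: "0 < s" unfolding s_def using zpos by (intro sum_pos) auto
  have w: "w \<in> Zint Cf" unfolding w_def by (rule prox_explicit_Zint[OF Cf z])
  have wi: "snd w $ i = snd z $ i * ?e i / s" for i
    by (simp add: w_def prox_explicit_def s_def)
  have lnw: "ln (snd w $ i) = ln (snd z $ i) - ?c * snd \<zeta> $ i - ln s" for i
    unfolding wi using zpos[of i] s by (simp add: ln_div ln_mult)
  have "snd (\<zeta> + (grad (omega Cf) w - grad (omega Cf) z)) $ i = - ln s / ?c" for i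
    using w z c by (subst (1 2) grad_omega) (auto simp: Zint_iff lnw field_simps)
  then have "snd (\<zeta> + (grad (omega Cf) w - grad (omega Cf) z)) \<bullet> snd (u - w)
      = (\<Sum>i\<in>UNIV. - ln s / ?c * (snd u $ i - snd w $ i))"
    by (simp add: inner_vec_def)
  also have "\<dots> = - ln s / ?c * ((\<Sum>i\<in>UNIV. snd u $ i) - (\<Sum>i\<in>UNIV. snd w $ i))"
    by (simp only: sum_distrib_left[symmetric] sum_subtractf)
  also have "\<dots> = 0"
    using u w by (simp add: Zint_iff Zset_iff)
  finally have snd0: "snd (\<zeta> + (grad (omega Cf) w - grad (omega Cf) z)) \<bullet> snd (u - w) = 0" .
  have "(fst z - Cf\<^sup>2 *\<^sub>R fst \<zeta> - fst w) \<bullet> (fst u - fst w) \<le> 0"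
    unfolding w_def prox_explicit_def fst_conv using u
    by (intro closest_point_dot) (auto simp: Zset_iff)
  moreover have "Cf\<^sup>2 *\<^sub>R fst (\<zeta> + (grad (omega Cf) w - grad (omega Cf) z))
      = - (fst z - Cf\<^sup>2 *\<^sub>R fst \<zeta> - fst w)"
  proof -
    have "fst (\<zeta> + (grad (omega Cf) w - grad (omega Cf) z))
        = fst \<zeta> + (fst w /\<^sub>R Cf\<^sup>2 - fst z /\<^sub>R Cf\<^sup>2)"
      using w z by (simp add: grad_omega Zint_iff)
    then show ?thesis
      using Cf by (simp add: scaleR_add_right scaleR_diff_right)
  qed
  ultimately have "0 \<le> (Cf\<^sup>2 *\<^sub>R fst (\<zeta> + (grad (omega Cf) w - grad (omega Cf) z))) \<bullet> (fst u - fst w)"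
    by (simp only: inner_minus_left neg_0_le_iff_le)
  then have "0 \<le> Cf\<^sup>2 * (fst (\<zeta> + (grad (omega Cf) w - grad (omega Cf) z)) \<bullet> (fst u - fst w))"
    by (simp only: inner_scaleR_left)
  then have "0 \<le> fst (\<zeta> + (grad (omega Cf) w - grad (omega Cf) z)) \<bullet> fst (u - w)"
    using Cf by (simp only: zero_le_mult_iff fst_diff) auto
  then show ?thesis
    unfolding inner_prod_def snd0 by simp
qed

lemma prox_eq:
  fixes z \<zeta> :: "(real^'n) \<times> (real^'m)"
  assumes m: "2 \<le> CARD('m)" and Cf: "0 < Cf" and z: "z \<in> Zint Cf"
  shows "prox Cf z \<zeta> = prox_explicit Cf z \<zeta>"
proof -
  let ?w = "prox_explicit Cf z \<zeta>"
  let ?obj = "\<lambda>u. \<zeta> \<bullet> (u - z) + bregman Cf z u"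
  have w: "?w \<in> Zint Cf" by (rule prox_explicit_Zint[OF Cf z])
  \<comment> \<open>The objective grows quadratically away from \<open>?w\<close>: the linear part
    is nonnegative by optimality, and a Bregman distance from \<open>?w\<close> remains. Thus
    \<open>?w\<close> is the only minimiser, and the choice made by \<open>arg_min\<close> must be
    \<open>?w\<close>.\<close>
  have gap: "kappa Cf CARD('m) * (norm (u - ?w))\<^sup>2 \<le> ?obj u - ?obj ?w" if u: "u \<in> Zset Cf" for u
  proof -
    have "?obj u - ?obj ?w = (\<zeta> + (grad (omega Cf) ?w - grad (omega Cf) z)) \<bullet> (u - ?w)
        + bregman Cf ?w u"
      using bregman_three_point[of Cf z u ?w]
      by (simp add: inner_add_left inner_diff_right algebra_simps)
    then show ?thesis
      using prox_explicit_variational[OF m Cf z u, of \<zeta>] bregman_lower[OF m Cf w u] by linarith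
  qed
  have nn: "0 \<le> kappa Cf CARD('m) * (norm (u - ?w))\<^sup>2" for u
    using kappa_pos[OF Cf m] by simp
  have "prox Cf z \<zeta> \<in> Zset Cf \<and> ?obj (prox Cf z \<zeta>) \<le> ?obj ?w"
    unfolding prox_def
  proof (rule arg_minI)
    show "?w \<in> Zset Cf" using w by (simp add: Zint_iff)
    show "\<not> ?obj u < ?obj ?w" if "u \<in> Zset Cf" for u
      using gap[OF that] nn[of u] by linarith
  next
    fix x assume "x \<in> Zset Cf" "\<forall>y. y \<in> Zset Cf \<longrightarrow> \<not> ?obj y < ?obj x"
    then show "x \<in> Zset Cf \<and> ?obj x \<le> ?obj ?w"
      using w unfolding Zint_iff not_less by blast
  qed
  then have "kappa Cf CARD('m) * (norm (prox Cf z \<zeta> - ?w))\<^sup>2 \<le> 0"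
    using gap[of "prox Cf z \<zeta>"] by linarith
  then show ?thesis
    using kappa_pos[OF Cf m] by (simp add: mult_le_0_iff)
qed

lemma prox_Zint:
  fixes z \<zeta> :: "(real^'n) \<times> (real^'m)"
  assumes "2 \<le> CARD('m)" "0 < Cf" "z \<in> Zint Cf"
  shows "prox Cf z \<zeta> \<in> Zint Cf"
  using prox_eq[OF assms] prox_explicit_Zint[OF assms(2,3)] by metis

text \<open>The three-point identity bounds the progress against the new point \<open>w\<close>; the
  remaining \<open>\<zeta> \<bullet> (z - w)\<close> is split by Young's inequality so that its
  quadratic part is paid by the distance from \<open>z\<close> to \<open>w\<close>.\<close>

lemma prox_step:
  fixes z \<zeta> u :: "(real^'n) \<times> (real^'m)"
  assumes m: "2 \<le> CARD('m)" and Cf: "0 < Cf" and z: "z \<in> Zint Cf" and u: "u \<in> Zset Cf"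
  shows "\<zeta> \<bullet> (z - u) \<le> bregman Cf z u - bregman Cf (prox Cf z \<zeta>) u
    + (norm \<zeta>)\<^sup>2 / (4 * kappa Cf CARD('m))"
proof -
  define w where "w = prox Cf z \<zeta>"
  define \<kappa> where "\<kappa> = kappa Cf CARD('m)"
  have \<kappa>: "0 < \<kappa>" unfolding \<kappa>_def by (rule kappa_pos[OF Cf m])
  have "0 \<le> (\<zeta> + (grad (omega Cf) w - grad (omega Cf) z)) \<bullet> (u - w)"
    unfolding w_def prox_eq[OF m Cf z] by (rule prox_explicit_variational[OF m Cf z u])
  then have tp: "\<zeta> \<bullet> (w - u) \<le> bregman Cf z u - bregman Cf w u - bregman Cf z w"
    unfolding bregman_three_point by (simp add: inner_add_left inner_diff_right)
  have low: "\<kappa> * (norm (w - z))\<^sup>2 \<le> bregman Cf z w"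
    unfolding \<kappa>_def w_def using prox_Zint[OF m Cf z]
    by (intro bregman_lower[OF m Cf z]) (simp add: Zint_iff)
  have "\<zeta> \<bullet> (z - w) \<le> norm \<zeta> * norm (w - z)"
    using norm_cauchy_schwarz[of \<zeta> "z - w"] by (simp add: norm_minus_commute)
  also have "\<dots> \<le> \<kappa> * (norm (w - z))\<^sup>2 + (norm \<zeta>)\<^sup>2 / (4 * \<kappa>)"
  proof -
    \<comment> \<open>Completing the square: the optimal splitting for coefficient \<kappa> leaves 1
      / (4 \<kappa>).\<close>
    have "0 \<le> (2 * \<kappa> * norm (w - z) - norm \<zeta>)\<^sup>2 / (4 * \<kappa>)"
      using \<kappa> by simp
    also have "\<dots> = \<kappa> * (norm (w - z))\<^sup>2 + (norm \<zeta>)\<^sup>2 / (4 * \<kappa>) - norm \<zeta> * norm (w - z)"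
      using \<kappa> by (simp add: power2_diff power_mult_distrib field_simps power2_eq_square)
    finally show ?thesis by simp
  qed
  finally have "\<zeta> \<bullet> (z - w) \<le> bregman Cf z w + (norm \<zeta>)\<^sup>2 / (4 * \<kappa>)"
    using low by linarith
  then show ?thesis
    using tp unfolding \<kappa>_def[symmetric] w_def[symmetric] by (simp add: inner_diff_right)
qed

lemma inner_iter_Zint:
  fixes G :: "'m::finite \<Rightarrow> real^'n \<Rightarrow> 'xi \<Rightarrow> real^'n"
  assumes "2 \<le> CARD('m)" "0 < Cf"
  shows "inner_iter Cf \<gamma> G x y s \<in> Zint Cf"
  by (induction s) (use assms in \<open>auto simp: Let_def Zint_iff[of "(0, _)"] Zset_iff intro: prox_Zint\<close>)

subsection \<open>The common descent direction\<close>

definition max_inner :: "('m::finite \<Rightarrow> 'a::real_inner) \<Rightarrow> 'a \<Rightarrow> real" where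
  "max_inner g d = (MAX i\<in>UNIV. g i \<bullet> d)"

text \<open>\<open>steepest_dir\<close> with arbitrary vectors in place of the gradients, so that
  its dependence on them can be studied apart from any function.\<close>

definition common_descent :: "('m::finite \<Rightarrow> 'a::euclidean_space) \<Rightarrow> 'a" where
  "common_descent g = arg_min (\<lambda>d. (MAX i\<in>UNIV. g i \<bullet> d) + (norm d)\<^sup>2 / 2) (\<lambda>_. True)"

lemma steepest_dir_eq: "steepest_dir f x = common_descent (\<lambda>i. grad (f i) x)"
  by (simp add: steepest_dir_def common_descent_def)

lemma max_inner_ge: "g i \<bullet> d \<le> max_inner g d"
  unfolding max_inner_def by (rule Max_ge) auto

lemma max_inner_leI: "(\<And>i. g i \<bullet> d \<le> c) \<Longrightarrow> max_inner g d \<le> c"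
  unfolding max_inner_def by (rule Max.boundedI) auto

lemma max_inner_0 [simp]: "max_inner (\<lambda>_. 0) d = 0" "max_inner g 0 = 0"
  by (simp_all add: max_inner_def)

lemma max_inner_subadditive:
  "max_inner g (d + e) \<le>
    max_inner g d + max_inner g e"
  by (rule max_inner_leI) (simp add: inner_add_right add_mono max_inner_ge)

lemma max_inner_scaleR_le:
  assumes "0 \<le> t"
  shows "max_inner g (t *\<^sub>R d) \<le> t * max_inner g d"
  using assms by (intro max_inner_leI) (simp add: mult_left_mono max_inner_ge)

lemma max_inner_le:
  "max_inner g d \<le> max_inner h d + (\<Sum>i\<in>UNIV. norm (g i - h i)) * norm d"
proof (rule max_inner_leI)
  fix i
  have "(g i - h i) \<bullet> d \<le> norm (g i - h i) * norm d"
    by (rule norm_cauchy_schwarz)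
  also have "\<dots> \<le> (\<Sum>i\<in>UNIV. norm (g i - h i)) * norm d"
    by (intro mult_right_mono member_le_sum) auto
  finally show "g i \<bullet> d \<le> max_inner h d + (\<Sum>i\<in>UNIV. norm (g i - h i)) * norm d"
    using max_inner_ge[of h i d] unfolding inner_diff_left by linarith
qed

lemma common_descent_minimal:
  fixes g :: "'m::finite \<Rightarrow> 'a::euclidean_space"
  shows "max_inner g (common_descent g) + (norm (common_descent g))\<^sup>2 / 2
    \<le> max_inner g d + (norm d)\<^sup>2 / 2"
proof -
  let ?h = "max_inner g"
  let ?\<phi> = "\<lambda>d. ?h d + (norm d)\<^sup>2 / 2"
  \<comment> \<open>\<open>B\<close> is a Lipschitz constant of the maximum, hence also a bound on
    its decay along rays.\<close>
  define B where "B = (\<Sum>i\<in>UNIV. norm (g i))"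
  have B: "0 \<le> B" by (simp add: B_def sum_nonneg)
  have le: "?h d \<le> B * norm d" for d
    using max_inner_le[of g d "\<lambda>_. 0"] by (simp add: B_def)
  have lip: "?h d - ?h e \<le> B * norm (d - e)" for d e
    using max_inner_subadditive[of g e "d - e"] le[of "d - e"] by simp
  have "B-lipschitz_on UNIV ?h"
  proof (rule lipschitz_onI)
    show "dist (?h d) (?h e) \<le> B * dist d e" for d e
      using lip[of d e] lip[of e d] by (simp add: dist_norm norm_minus_commute abs_le_iff)
  qed (rule B)
  then have "continuous_on UNIV ?h"
    by (rule lipschitz_on_continuous_on)
  \<comment> \<open>Since the maximum is at least \<open>- B * norm d\<close>, the objective is
    nonnegative outside radius \<open>2 * B\<close>, while its value at 0 is 0. A minimiser on this
    ball is therefore global.\<close>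
  then have "continuous_on (cball 0 (2 * B)) ?\<phi>"
    by (intro continuous_intros) (auto elim: continuous_on_subset)
  then have "\<exists>p\<in>cball 0 (2 * B). \<forall>d\<in>cball 0 (2 * B). ?\<phi> p \<le> ?\<phi> d"
    using B by (intro continuous_attains_inf) auto
  then obtain p where p: "\<And>d. d \<in> cball 0 (2 * B) \<Longrightarrow> ?\<phi> p \<le> ?\<phi> d"
    by blast
  have all: "?\<phi> p \<le> ?\<phi> d" for d
  proof (cases "d \<in> cball 0 (2 * B)")
    case False
    then have "0 \<le> (norm d - 2 * B) * norm d"
      by (intro mult_nonneg_nonneg) auto
    then have "B * norm d \<le> (norm d)\<^sup>2 / 2"
      by (simp add: power2_eq_square algebra_simps)
    moreover have "- (B * norm d) \<le> ?h d"
      using lip[of 0 d] by simp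
    moreover have "?\<phi> p \<le> 0"
      using p[of 0] B by simp
    ultimately show ?thesis by linarith
  qed (rule p)
  show ?thesis
    unfolding common_descent_def max_inner_def[symmetric]
    by (rule arg_minI[where P = "\<lambda>_. True" and Q = "\<lambda>x. ?\<phi> x \<le> ?\<phi> d"])
       (use all in \<open>auto simp: not_less\<close>)
qed

text \<open>Along the ray \<open>t d\<close> through the minimiser \<open>d\<close> the objective is stationary at \<open>t = 1\<close>.\<close>

lemma max_inner_common_descent:
  fixes g :: "'m::finite \<Rightarrow> 'a::euclidean_space"
  shows "max_inner g (common_descent g) = - (norm (common_descent g))\<^sup>2"
proof -
  let ?d = "common_descent g"
  let ?a = "max_inner g ?d" and ?b = "(norm ?d)\<^sup>2"
  have "DERIV (\<lambda>t. t * ?a + t\<^sup>2 * ?b / 2) 1 :> ?a + ?b"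
    by (auto intro!: derivative_eq_intros)
  \<comment> \<open>Homogeneity is available for nonnegative \<open>t\<close> only; radius 1 around
    \<open>t = 1\<close> stays in that range.\<close>
  moreover have "1 * ?a + 1\<^sup>2 * ?b / 2 \<le> t * ?a + t\<^sup>2 * ?b / 2" if "\<bar>1 - t\<bar> < 1" for t
  proof -
    have "0 \<le> t" using that by linarith
    then show ?thesis
      using common_descent_minimal[of g "t *\<^sub>R ?d"] max_inner_scaleR_le[of t g ?d]
      by (simp add: power_mult_distrib)
  qed
  ultimately have "?a + ?b = 0"
    using DERIV_local_min[of "\<lambda>t. t * ?a + t\<^sup>2 * ?b / 2" "?a + ?b" 1 1] by simp
  then show ?thesis by linarith
qed

text \<open>Cauchy-Schwarz applied to the stationarity identity. Together with the bound on the
  gradients it places \<open>d_k\<close> in the ball of radius \<open>Cf\<close>, so that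
  \<open>d_k\<close> may serve as a comparison point in \<open>Zset\<close>.\<close>

lemma norm_common_descent_le:
  fixes g :: "'m::finite \<Rightarrow> 'a::euclidean_space"
  shows "norm (common_descent g) \<le> norm (g i)"
proof -
  have "(norm (common_descent g))\<^sup>2 \<le> - (g i \<bullet> common_descent g)"
    using max_inner_ge[of g i "common_descent g"] max_inner_common_descent[of g] by linarith
  also have "\<dots> \<le> norm (g i) * norm (common_descent g)"
    using norm_cauchy_schwarz[of "- g i" "common_descent g"] by simp
  finally have "norm (common_descent g) * norm (common_descent g) \<le> norm (g i) * norm (common_descent g)"
    by (simp add: power2_eq_square)
  then show ?thesis
    by (cases "norm (common_descent g) = 0") (auto dest: mult_right_le_imp_le)
qed

text \<open>The minimiser is compared with the midpoint of it and \<open>d\<close>: the maximum is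
  convex there, and the parallelogram law supplies the quadratic gain. The midpoint costs the factor
  4.\<close>

lemma common_descent_strong_min:
  fixes g :: "'m::finite \<Rightarrow> 'a::euclidean_space"
  shows "(norm (d - common_descent g))\<^sup>2 \<le>
    4 * (max_inner g d + (norm d)\<^sup>2 / 2
      - (max_inner g (common_descent g) + (norm (common_descent g))\<^sup>2 / 2))"
proof -
  let ?c = "common_descent g" and ?h = "max_inner g"
  have "?h ?c + (norm ?c)\<^sup>2 / 2 \<le> ?h ((1/2) *\<^sub>R (?c + d)) + (norm ((1/2) *\<^sub>R (?c + d)))\<^sup>2 / 2"
    by (rule common_descent_minimal)
  moreover have "?h ((1/2) *\<^sub>R (?c + d)) \<le> (?h ?c + ?h d) / 2"
    using max_inner_scaleR_le[of "1/2" g "?c + d"] max_inner_subadditive[of g ?c d] by simp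
  moreover have "(norm ((1/2) *\<^sub>R (?c + d)))\<^sup>2 = (norm (?c + d))\<^sup>2 / 4"
    by (simp add: norm_scaleR power_mult_distrib power_divide del: scaleR_half_double)
  moreover have "(norm (?c + d))\<^sup>2 + (norm (d - ?c))\<^sup>2 = 2 * (norm ?c)\<^sup>2 + 2 * (norm d)\<^sup>2"
    unfolding power2_norm_eq_inner inner_add_left inner_add_right inner_diff_left inner_diff_right
    by (simp add: inner_commute)
  ultimately show ?thesis by argo
qed

text \<open>Adding the two strong-minimum inequalities, each tested at the other minimiser, cancels
  the quadratic terms and leaves only differences of the two maxima. The resulting Hoelder bound of
  order 1/2 is what makes \<open>d_k\<close> a continuous, hence Borel, function of
  \<open>x_k\<close>.\<close>

lemma common_descent_perturb:
  fixes g h :: "'m::finite \<Rightarrow> 'a::euclidean_space"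
  shows "(norm (common_descent g - common_descent h))\<^sup>2
    \<le> 2 * (\<Sum>i\<in>UNIV. norm (g i - h i)) * (norm (g j) + norm (h j))"
proof -
  let ?c = "common_descent g" and ?d = "common_descent h"
  let ?e = "\<Sum>i\<in>UNIV. norm (g i - h i)"
  have "(norm (?c - ?d))\<^sup>2 \<le> 2 * ?e * (norm ?d + norm ?c)"
    using common_descent_strong_min[of ?d g] common_descent_strong_min[of ?c h]
      max_inner_le[of g ?d h] max_inner_le[of h ?c g]
    by (simp add: norm_minus_commute algebra_simps)
  also have "\<dots> \<le> 2 * ?e * (norm (g j) + norm (h j))"
    using norm_common_descent_le[of g j] norm_common_descent_le[of h j]
    by (intro mult_left_mono) (auto simp: sum_nonneg)
  finally show ?thesis .
qed

lemma continuous_common_descent: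
  fixes g :: "'m::finite \<Rightarrow> 'b::metric_space \<Rightarrow> 'a::euclidean_space"
  assumes "\<And>i. continuous_on UNIV (g i)"
  shows "continuous_on UNIV (\<lambda>x. common_descent (\<lambda>i. g i x))"
  unfolding continuous_on_def
proof
  fix x :: 'b
  obtain j :: 'm where True by simp
  have g: "(g i \<longlongrightarrow> g i x) (at x)" for i
    using assms[of i] by (simp add: continuous_on_def)
  have "((\<lambda>y. 2 * (\<Sum>i\<in>UNIV. norm (g i y - g i x)) * (norm (g j y) + norm (g j x))) \<longlongrightarrow>
      2 * (\<Sum>i\<in>UNIV. norm (g i x - g i x)) * (norm (g j x) + norm (g j x))) (at x)"
    by (intro tendsto_intros g)
  then have "((\<lambda>y. 2 * (\<Sum>i\<in>UNIV. norm (g i y - g i x)) * (norm (g j y) + norm (g j x))) \<longlongrightarrow> 0) (at x)"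
    by simp
  then have "((\<lambda>y. (norm (common_descent (\<lambda>i. g i y) - common_descent (\<lambda>i. g i x)))\<^sup>2) \<longlongrightarrow> 0) (at x)"
    by (rule tendsto_sandwich[OF _ _ tendsto_const, rotated 2])
       (auto intro!: always_eventually common_descent_perturb)
  then have "((\<lambda>y. sqrt ((norm (common_descent (\<lambda>i. g i y) - common_descent (\<lambda>i. g i x)))\<^sup>2)) \<longlongrightarrow> sqrt 0) (at x)"
    by (rule tendsto_real_sqrt)
  then have "((\<lambda>y. norm (common_descent (\<lambda>i. g i y) - common_descent (\<lambda>i. g i x))) \<longlongrightarrow> 0) (at x)"
    by simp
  then show "((\<lambda>x. common_descent (\<lambda>i. g i x)) \<longlongrightarrow> common_descent (\<lambda>i. g i x)) (at x within UNIV)"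
    by (rule Lim_null[THEN iffD2, OF tendsto_norm_zero_cancel])
qed

section \<open>The saddle inequality and one averaged descent step\<close>

definition mean_field :: "('m::finite \<Rightarrow> real^'n) \<Rightarrow> (real^'n) \<times> (real^'m) \<Rightarrow> (real^'n) \<times> (real^'m)" where
  "mean_field g z = ((\<Sum>i\<in>UNIV. snd z $ i *\<^sub>R g i) + fst z, \<chi> i. - (g i \<bullet> fst z))"

text \<open>In the inner product the terms \<open>g j \<bullet> fst z\<close> weighted by \<lambda>
  cancel between the two blocks. What remains is bounded by two facts: each \<open>g j\<close> has
  inner product at most minus the squared norm with the common descent direction, and
  \<open>fst z \<bullet> ?c\<close> obeys Young's inequality.\<close>

lemma saddle_gap:
  fixes g :: "'m::finite \<Rightarrow> real^'n"
  assumes "z \<in> Zset Cf"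
  shows "g i \<bullet> fst z + (norm (fst z))\<^sup>2 / 2 + (norm (common_descent g))\<^sup>2 / 2
    \<le> mean_field g z \<bullet> (z - (common_descent g, axis i 1))"
proof -
  let ?c = "common_descent g" and ?d = "fst z" and ?l = "snd z"
  have l: "\<And>j. 0 \<le> ?l $ j" "(\<Sum>j\<in>UNIV. ?l $ j) = 1"
    using assms by (auto simp: Zset_iff)
  have "(\<Sum>j\<in>UNIV. ?l $ j * (g j \<bullet> ?c)) \<le> (\<Sum>j\<in>UNIV. ?l $ j * (- (norm ?c)\<^sup>2))"
  proof (intro sum_mono mult_left_mono l(1))
    show "g j \<bullet> ?c \<le> - (norm ?c)\<^sup>2" for j
      using max_inner_ge[of g j ?c] max_inner_common_descent[of g] by linarith
  qed
  also have "\<dots> = - (norm ?c)\<^sup>2"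
    using l(2) by (simp only: sum_distrib_right[symmetric])
  finally have 1: "(\<Sum>j\<in>UNIV. ?l $ j * (g j \<bullet> ?c)) \<le> - (norm ?c)\<^sup>2" .
  have 2: "?d \<bullet> ?c \<le> ((norm ?d)\<^sup>2 + (norm ?c)\<^sup>2) / 2"
  proof -
    have "0 \<le> (norm (?d - ?c))\<^sup>2" by simp
    then show ?thesis
      by (simp add: power2_norm_eq_inner inner_diff_left inner_diff_right inner_commute)
  qed
  have 3: "(\<Sum>j\<in>UNIV. ?l $ j *\<^sub>R g j) \<bullet> v = (\<Sum>j\<in>UNIV. ?l $ j * (g j \<bullet> v))" for v
    by (simp add: inner_sum_left)
  have "(\<chi> j. - (g j \<bullet> ?d)) \<bullet> (?l - axis i 1)
      = - (\<Sum>j\<in>UNIV. ?l $ j * (g j \<bullet> ?d)) + g i \<bullet> ?d"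
    by (simp add: inner_diff_right inner_axis) (simp add: inner_vec_def sum_negf mult.commute)
  then have "mean_field g z \<bullet> (z - (?c, axis i 1)) =
     g i \<bullet> ?d + (norm ?d)\<^sup>2 - ?d \<bullet> ?c - (\<Sum>j\<in>UNIV. ?l $ j * (g j \<bullet> ?c))"
    unfolding mean_field_def inner_prod_def fst_conv snd_conv fst_diff snd_diff
    by (simp add: inner_add_left inner_diff_right 3 power2_norm_eq_inner)
  then show ?thesis
    using 1 2 by (simp add: field_simps)
qed

lemma descent_step:
  fixes g :: "'a::euclidean_space \<Rightarrow> real"
  assumes "\<And>x. g differentiable (at x)" "L-lipschitz_on UNIV (grad g)"
    and L: "0 < L" and \<alpha>: "0 < \<alpha>" "\<alpha> \<le> 1 / (4 * L)"
  shows "g (x + \<alpha> *\<^sub>R d) \<le> g x + \<alpha> * (grad g x \<bullet> d + (norm d)\<^sup>2 / 2)"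
proof -
  have "\<alpha> * L \<le> 1 / 2"
    using L \<alpha> by (simp add: field_simps)
  then have "\<alpha> * ((\<alpha> * L) * (norm d)\<^sup>2) \<le> \<alpha> * (1 / 2 * (norm d)\<^sup>2)"
    using \<alpha> by (intro mult_left_mono mult_right_mono) auto
  then show ?thesis
    using descent[OF assms(1,2), of x "\<alpha> *\<^sub>R d"]
    by (simp add: power_mult_distrib power2_eq_square algebra_simps)
qed

lemma window_start_le_self:
  assumes "r \<le> 1"
  shows "window_start r S \<le> S"
  using mult_right_mono[OF assms, of "real S"]
  by (simp add: window_start_def nat_le_iff ceiling_le_iff)

lemma fst_window_avg: "fst (window_avg \<gamma> P S z) = window_avg \<gamma> P S (\<lambda>s. fst (z s))"
  by (simp add: window_avg_def fst_sum)

text \<open>Jensen's inequality in tangent form: each quadratic lies above its tangent at the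
  average \<open>a\<close>, and the tangents average exactly to the value at
  \<open>a\<close>.\<close>

lemma window_avg_convex:
  fixes d :: "nat \<Rightarrow> 'a::real_inner"
  assumes "0 < (\<Sum>s=P..S. \<gamma> s)" "\<And>s. s \<in> {P..S} \<Longrightarrow> 0 \<le> \<gamma> s"
  defines "a \<equiv> window_avg \<gamma> P S d"
  shows "(\<Sum>s=P..S. \<gamma> s) * (g \<bullet> a + (norm a)\<^sup>2 / 2) \<le> (\<Sum>s=P..S. \<gamma> s * (g \<bullet> d s + (norm (d s))\<^sup>2 / 2))"
proof -
  let ?\<Gamma> = "\<Sum>s=P..S. \<gamma> s"
  have a: "(\<Sum>s=P..S. \<gamma> s *\<^sub>R d s) = ?\<Gamma> *\<^sub>R a"
    using assms(1) by (simp add: a_def window_avg_def)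
  have lin: "(\<Sum>s=P..S. \<gamma> s * (v \<bullet> d s)) = ?\<Gamma> * (v \<bullet> a)" for v
    using arg_cong[OF a, of "\<lambda>w. v \<bullet> w"] by (simp add: inner_sum_right)
  have "?\<Gamma> * (g \<bullet> a + (norm a)\<^sup>2 / 2) = (\<Sum>s=P..S. \<gamma> s * ((g + a) \<bullet> d s)) - ?\<Gamma> * ((norm a)\<^sup>2 / 2)"
    unfolding lin by (simp add: inner_add_left power2_norm_eq_inner algebra_simps)
  also have "\<dots> = (\<Sum>s=P..S. \<gamma> s * ((g + a) \<bullet> d s - (norm a)\<^sup>2 / 2))"
    by (simp add: sum_distrib_right right_diff_distrib sum_subtractf)
  also have "\<dots> \<le> (\<Sum>s=P..S. \<gamma> s * (g \<bullet> d s + (norm (d s))\<^sup>2 / 2))"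
  proof (intro sum_mono mult_left_mono assms(2))
    fix s
    have "0 \<le> (norm (d s - a))\<^sup>2" by simp
    then show "(g + a) \<bullet> d s - (norm a)\<^sup>2 / 2 \<le> g \<bullet> d s + (norm (d s))\<^sup>2 / 2"
      unfolding power2_norm_eq_inner inner_diff_left inner_diff_right inner_add_left
        inner_commute[of "d s" a] by argo
  qed
  finally show ?thesis .
qed

lemma norm_window_avg_le:
  assumes "0 < (\<Sum>s=P..S. \<gamma> s)" "\<And>s. s \<in> {P..S} \<Longrightarrow> 0 \<le> \<gamma> s" "\<And>s. s \<in> {P..S} \<Longrightarrow> norm (d s) \<le> B"
  shows "norm (window_avg \<gamma> P S d) \<le> B"
proof -
  have "norm (\<Sum>s=P..S. \<gamma> s *\<^sub>R d s) \<le> (\<Sum>s=P..S. \<gamma> s * B)"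
    using assms(2,3) by (intro sum_norm_le) (auto intro: mult_left_mono)
  also have "\<dots> = B * (\<Sum>s=P..S. \<gamma> s)"
    by (simp add: sum_distrib_left mult.commute)
  finally have le: "norm (\<Sum>s=P..S. \<gamma> s *\<^sub>R d s) \<le> B * (\<Sum>s=P..S. \<gamma> s)" .
  have eq: "norm (window_avg \<gamma> P S d) = norm (\<Sum>s=P..S. \<gamma> s *\<^sub>R d s) / (\<Sum>s=P..S. \<gamma> s)"
    using assms(1) by (simp add: window_avg_def divide_inverse mult.commute)
  show ?thesis
    unfolding eq pos_divide_le_eq[OF assms(1)] by (rule le)
qed

subsection \<open>Measurability of the iterates\<close>

lemma borel_measurable_vec_lambda:
  fixes F :: "'m::finite \<Rightarrow> 'a \<Rightarrow> real"
  assumes "\<And>i. F i \<in> borel_measurable N"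
  shows "(\<lambda>x. \<chi> i. F i x) \<in> borel_measurable N"
proof -
  have "(\<lambda>x. \<Sum>i\<in>UNIV. F i x *\<^sub>R axis i 1 :: real^'m) \<in> borel_measurable N"
    using assms by (intro borel_measurable_sum borel_measurable_scaleR borel_measurable_const)
  also have "(\<lambda>x. \<Sum>i\<in>UNIV. F i x *\<^sub>R axis i 1 :: real^'m) = (\<lambda>x. \<chi> i. F i x)"
    by (simp add: fun_eq_iff vec_eq_iff axis_def if_distrib[of "\<lambda>t. _ * t"] cong: if_cong)
  finally show ?thesis .
qed

lemma borel_measurable_fst':
  fixes Z :: "'a \<Rightarrow> 'b::topological_space \<times> 'c::topological_space"
  assumes "Z \<in> borel_measurable N"
  shows "(\<lambda>x. fst (Z x)) \<in> borel_measurable N"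
  by (rule borel_measurable_continuous_on[OF _ assms]) (intro continuous_intros)

lemma borel_measurable_snd':
  fixes Z :: "'a \<Rightarrow> 'b::topological_space \<times> 'c::topological_space"
  assumes "Z \<in> borel_measurable N"
  shows "(\<lambda>x. snd (Z x)) \<in> borel_measurable N"
  by (rule borel_measurable_continuous_on[OF _ assms]) (intro continuous_intros)

lemma borel_measurable_component:
  fixes v :: "'a \<Rightarrow> real^'m"
  assumes "v \<in> borel_measurable N"
  shows "(\<lambda>x. v x $ i) \<in> borel_measurable N"
  by (rule borel_measurable_continuous_on[OF _ assms]) (intro continuous_intros)

lemma borel_measurable_prox_explicit:
  fixes Z \<zeta> :: "'a \<Rightarrow> (real^'n) \<times> (real^'m)"
  assumes Cf: "0 < Cf" and Z: "Z \<in> borel_measurable N" and \<zeta>: "\<zeta> \<in> borel_measurable N"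
  shows "(\<lambda>x. prox_explicit Cf (Z x) (\<zeta> x)) \<in> borel_measurable N"
  unfolding prox_explicit_def
proof (rule borel_measurable_Pair)
  have cp: "continuous_on UNIV (closest_point (cball 0 Cf :: (real^'n) set))"
    using Cf by (intro continuous_on_closest_point) auto
  have "(\<lambda>x. fst (Z x) - Cf\<^sup>2 *\<^sub>R fst (\<zeta> x)) \<in> borel_measurable N"
    by (intro borel_measurable_diff borel_measurable_scaleR borel_measurable_const
        borel_measurable_fst' Z \<zeta>)
  then show "(\<lambda>x. closest_point (cball 0 Cf) (fst (Z x) - Cf\<^sup>2 *\<^sub>R fst (\<zeta> x))) \<in> borel_measurable N"
    by (rule borel_measurable_continuous_on[OF cp])
next
  have [measurable]: "(\<lambda>x. snd (Z x) $ i) \<in> borel_measurable N"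
    "(\<lambda>x. snd (\<zeta> x) $ i) \<in> borel_measurable N" for i
    by (intro borel_measurable_component borel_measurable_snd' Z \<zeta>)+
  show "(\<lambda>x. \<chi> i. snd (Z x) $ i * exp (- (2 * ln (real CARD('m)) * snd (\<zeta> x) $ i)) /
       (\<Sum>j\<in>UNIV. snd (Z x) $ j * exp (- (2 * ln (real CARD('m)) * snd (\<zeta> x) $ j))))
     \<in> borel_measurable N"
    by (rule borel_measurable_vec_lambda) measurable
qed

lemma borel_measurable_subproblem_grad:
  fixes G :: "'m::finite \<Rightarrow> real^'n \<Rightarrow> 'xi \<Rightarrow> real^'n"
  assumes G: "\<And>i. (\<lambda>(x, y). G i x y) \<in> borel_measurable (borel \<Otimes>\<^sub>M Xi)"
    and X: "X \<in> borel_measurable N" and Z: "Z \<in> borel_measurable N" and y: "y \<in> measurable N Xi"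
  shows "(\<lambda>x. subproblem_grad G (X x) (Z x) (y x)) \<in> borel_measurable N"
  unfolding subproblem_grad_def
proof (rule borel_measurable_Pair)
  have Gm: "(\<lambda>x. G i (X x) (y x)) \<in> borel_measurable N" for i
    using measurable_compose[OF measurable_Pair[OF X y] G[of i]] by simp
  show "(\<lambda>x. (\<Sum>i\<in>UNIV. snd (Z x) $ i *\<^sub>R G i (X x) (y x)) + fst (Z x)) \<in> borel_measurable N"
    by (intro borel_measurable_add borel_measurable_sum borel_measurable_scaleR
        borel_measurable_component borel_measurable_snd' borel_measurable_fst' Z Gm)
  show "(\<lambda>x. \<chi> i. - (G i (X x) (y x) \<bullet> fst (Z x))) \<in> borel_measurable N"
    by (intro borel_measurable_vec_lambda borel_measurable_uminus borel_measurable_inner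
        borel_measurable_fst' Z Gm)
qed

text \<open>Measurability is demanded only of the samples before \<open>s\<close>, so that the lemma
  also applies on a product space carrying just the past coordinates. The iterates have positive
  weights, which allows \<open>prox\<close> to be replaced by its closed form.\<close>

lemma borel_measurable_inner_iter:
  fixes G :: "'m::finite \<Rightarrow> real^'n \<Rightarrow> 'xi \<Rightarrow> real^'n"
  assumes m: "2 \<le> CARD('m)" and Cf: "0 < Cf"
    and G: "\<And>i. (\<lambda>(x, y). G i x y) \<in> borel_measurable (borel \<Otimes>\<^sub>M Xi)"
    and X: "X \<in> borel_measurable N" and y: "\<And>t. t < s \<Longrightarrow> y t \<in> measurable N Xi"
  shows "(\<lambda>p. inner_iter Cf \<gamma> G (X p) (\<lambda>t. y t p) s) \<in> borel_measurable N"
  using y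
proof (induction s)
  case 0
  show ?case by simp
next
  case (Suc s)
  let ?z = "\<lambda>p. inner_iter Cf \<gamma> G (X p) (\<lambda>t. y t p) s"
  have z: "?z \<in> borel_measurable N"
    using Suc by simp
  have "(\<lambda>p. prox_explicit Cf (?z p) (\<gamma> s *\<^sub>R subproblem_grad G (X p) (?z p) (y s p))) \<in> borel_measurable N"
    by (intro borel_measurable_prox_explicit[OF Cf z] borel_measurable_scaleR borel_measurable_const
        borel_measurable_subproblem_grad[OF G X z]) (use Suc.prems in simp)
  then show ?case
    by (simp only: inner_iter.simps Let_def prox_eq[OF m Cf inner_iter_Zint[OF m Cf]])
qed

lemma borel_measurable_msmd:
  fixes G :: "'m::finite \<Rightarrow> real^'n \<Rightarrow> 'xi \<Rightarrow> real^'n"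
  assumes m: "2 \<le> CARD('m)" and Cf: "0 < Cf"
    and G: "\<And>i. (\<lambda>(x, y). G i x y) \<in> borel_measurable (borel \<Otimes>\<^sub>M Xi)"
    and y: "\<And>j t. j < k \<Longrightarrow> y j t \<in> measurable N Xi"
  shows "(\<lambda>p. msmd Cf \<gamma> \<alpha> r G x0 S (\<lambda>j t. y j t p) k) \<in> borel_measurable N"
  using y
proof (induction k)
  case 0
  show ?case by simp
next
  case (Suc k)
  let ?x = "\<lambda>p. msmd Cf \<gamma> \<alpha> r G x0 S (\<lambda>j t. y j t p) k"
  have x: "?x \<in> borel_measurable N"
    using Suc by simp
  have z: "(\<lambda>p. inner_iter Cf \<gamma> G (?x p) (\<lambda>t. y k t p) s) \<in> borel_measurable N" for s
    by (rule borel_measurable_inner_iter[OF m Cf G x]) (use Suc.prems in simp)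
  show ?case
    unfolding msmd.simps Let_def fst_window_avg window_avg_def
    by (intro borel_measurable_add borel_measurable_scaleR borel_measurable_const
        borel_measurable_sum borel_measurable_fst' x z)
qed

lemma inner_iter_cong:
  "(\<And>t. t < s \<Longrightarrow> y t = y' t) \<Longrightarrow> inner_iter Cf \<gamma> G x y s = inner_iter Cf \<gamma> G x y' s"
  by (induction s) (simp_all add: Let_def)

lemma msmd_cong:
  "(\<And>j t. j < k \<Longrightarrow> y j t = y' j t) \<Longrightarrow> msmd Cf \<gamma> \<alpha> r G x0 S y k = msmd Cf \<gamma> \<alpha> r G x0 S y' k"
proof (induction k)
  case (Suc k)
  have "y k = y' k"
    using Suc.prems by auto
  then show ?case
    using Suc by simp
qed simp

subsection \<open>Integrating out a fresh sample\<close>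

text \<open>Independence enters as factorisation of the joint law, so holding the past fixed is
  Tonelli's theorem and no conditional expectation is needed. This nonnegative form provides the
  integrability that the signed form then presupposes.\<close>

lemma (in prob_space) nn_integral_fresh:
  assumes W: "W \<in> measurable M N" and Y: "Y \<in> measurable M T"
    and joint: "distr M N W \<Otimes>\<^sub>M distr M T Y = distr M (N \<Otimes>\<^sub>M T) (\<lambda>x. (W x, Y x))"
    and g: "g \<in> borel_measurable (N \<Otimes>\<^sub>M T)"
  shows "(\<integral>\<^sup>+\<omega>. g (W \<omega>, Y \<omega>) \<partial>M) = (\<integral>\<^sup>+\<omega>. (\<integral>\<^sup>+y. g (W \<omega>, y) \<partial>distr M T Y) \<partial>M)"
proof -
  interpret Q: prob_space "distr M T Y" by (rule prob_space_distr[OF Y])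
  have g': "g \<in> borel_measurable (distr M N W \<Otimes>\<^sub>M distr M T Y)"
    unfolding joint using g by simp
  have "(\<integral>\<^sup>+\<omega>. g (W \<omega>, Y \<omega>) \<partial>M) = integral\<^sup>N (distr M N W \<Otimes>\<^sub>M distr M T Y) g"
    unfolding joint by (subst nn_integral_distr) (use g W Y in auto)
  also have "\<dots> = (\<integral>\<^sup>+x. (\<integral>\<^sup>+y. g (x, y) \<partial>distr M T Y) \<partial>distr M N W)"
    by (rule Q.nn_integral_fst[OF g', symmetric])
  also have "\<dots> = (\<integral>\<^sup>+\<omega>. (\<integral>\<^sup>+y. g (W \<omega>, y) \<partial>distr M T Y) \<partial>M)"
    by (rule nn_integral_distr[OF W Q.borel_measurable_nn_integral_fst[OF g']])
  finally show ?thesis .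
qed

lemma (in prob_space) integral_fresh:
  fixes g :: "_ \<Rightarrow> real"
  assumes W: "W \<in> measurable M N" and Y: "Y \<in> measurable M T"
    and joint: "distr M N W \<Otimes>\<^sub>M distr M T Y = distr M (N \<Otimes>\<^sub>M T) (\<lambda>x. (W x, Y x))"
    and g: "g \<in> borel_measurable (N \<Otimes>\<^sub>M T)"
    and int: "integrable M (\<lambda>\<omega>. g (W \<omega>, Y \<omega>))"
  shows "(\<integral>\<omega>. g (W \<omega>, Y \<omega>) \<partial>M) = (\<integral>\<omega>. (\<integral>y. g (W \<omega>, y) \<partial>distr M T Y) \<partial>M)"
proof -
  interpret P: prob_space "distr M N W" by (rule prob_space_distr[OF W])
  interpret Q: prob_space "distr M T Y" by (rule prob_space_distr[OF Y])
  interpret PQ: pair_sigma_finite "distr M N W" "distr M T Y" ..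
  have WY: "(\<lambda>x. (W x, Y x)) \<in> measurable M (N \<Otimes>\<^sub>M T)"
    by (rule measurable_Pair[OF W Y])
  have int': "integrable (distr M N W \<Otimes>\<^sub>M distr M T Y) g"
    unfolding joint by (subst integrable_distr_eq[OF WY g]) (rule int)
  have "(\<integral>\<omega>. g (W \<omega>, Y \<omega>) \<partial>M) = integral\<^sup>L (distr M N W \<Otimes>\<^sub>M distr M T Y) g"
    unfolding joint by (rule integral_distr[OF WY g, symmetric])
  also have "\<dots> = (\<integral>x. (\<integral>y. g (x, y) \<partial>distr M T Y) \<partial>distr M N W)"
    by (rule PQ.integral_fst'[OF int', symmetric])
  also have "\<dots> = (\<integral>\<omega>. (\<integral>y. g (W \<omega>, y) \<partial>distr M T Y) \<partial>M)"
  proof (rule integral_distr[OF W])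
    have "(\<lambda>x. \<integral>y. g (x, y) \<partial>distr M T Y) \<in> borel_measurable (distr M N W)"
      using PQ.integrable_fst'[OF int'] by (rule borel_measurable_integrable)
    then show "(\<lambda>x. \<integral>y. g (x, y) \<partial>distr M T Y) \<in> borel_measurable N"
      by simp
  qed
  finally show ?thesis .
qed

subsection \<open>A run of the method\<close>

text \<open>The schedule \<open>S\<close> is left out of the locale, so one interpretation serves
  both parts of the theorem. The inner steps are merely positive here; their formula enters only
  with the rate.\<close>

locale msmd_run = prob_space M
  for M :: "'w measure" +
  fixes f :: "'m::finite \<Rightarrow> real^'n \<Rightarrow> real"
    and G :: "'m \<Rightarrow> real^'n \<Rightarrow> 'xi \<Rightarrow> real^'n"
    and Xi :: "'xi measure"
    and \<xi> :: "nat \<Rightarrow> nat \<Rightarrow> 'w \<Rightarrow> 'xi"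
    and L Cf \<delta> \<alpha> r :: real
    and x0 :: "real^'n" and \<gamma> :: "nat \<Rightarrow> real"
  assumes card: "2 \<le> CARD('m)"
    and diff: "\<And>i x. f i differentiable (at x)"
    and lip: "\<And>i. L-lipschitz_on UNIV (grad (f i))"
    and L: "0 < L"
    and Xi: "prob_space Xi"
    and G: "\<And>i. (\<lambda>(x, y). G i x y) \<in> borel_measurable (borel \<Otimes>\<^sub>M Xi)"
    and indep: "indep_vars (\<lambda>_. Xi) (\<lambda>(k, s). \<xi> k s) UNIV"
    and distr: "\<And>k s. distr M Xi (\<xi> k s) = Xi"
    and Cf: "0 < Cf"
    and \<alpha>: "0 < \<alpha>" "\<alpha> \<le> 1 / (4 * L)"
    and r: "0 < r" "r < 1"
    and \<gamma>: "\<And>s. 0 < \<gamma> s"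
begin

definition X :: "(nat \<Rightarrow> nat) \<Rightarrow> nat \<Rightarrow> 'w \<Rightarrow> real^'n" where
  "X S k \<omega> = msmd Cf \<gamma> (\<lambda>_. \<alpha>) r G x0 S (\<lambda>k s. \<xi> k s \<omega>) k"

definition Z :: "(nat \<Rightarrow> nat) \<Rightarrow> nat \<Rightarrow> nat \<Rightarrow> 'w \<Rightarrow> (real^'n) \<times> (real^'m)" where
  "Z S k s \<omega> = inner_iter Cf \<gamma> G (X S k \<omega>) (\<lambda>s. \<xi> k s \<omega>) s"

definition noisy :: "(nat \<Rightarrow> nat) \<Rightarrow> nat \<Rightarrow> nat \<Rightarrow> 'w \<Rightarrow> (real^'n) \<times> (real^'m)" where
  "noisy S k s \<omega> = subproblem_grad G (X S k \<omega>) (Z S k s \<omega>) (\<xi> k s \<omega>)"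

definition dirn :: "real^'n \<Rightarrow> real^'n" where
  "dirn x = common_descent (\<lambda>i. grad (f i) x)"

lemma sample_measurable: "\<xi> k s \<in> measurable M Xi"
  using indep unfolding indep_vars_def by auto

lemma X_Suc: "X S (Suc k) \<omega> = X S k \<omega> +
    \<alpha> *\<^sub>R window_avg \<gamma> (window_start r (S k)) (S k) (\<lambda>s. fst (Z S k s \<omega>))"
  by (simp add: X_def Z_def Let_def fst_window_avg)

lemma Z_Suc: "Z S k (Suc s) \<omega> = prox Cf (Z S k s \<omega>) (\<gamma> s *\<^sub>R noisy S k s \<omega>)"
  by (simp add: Z_def noisy_def Let_def)

lemma Z_Zint: "Z S k s \<omega> \<in> Zint Cf"
  unfolding Z_def by (rule inner_iter_Zint[OF card Cf])

lemma Z_Zset: "Z S k s \<omega> \<in> Zset Cf"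
  using Z_Zint by (simp add: Zint_iff)

lemma X_measurable [measurable]: "X S k \<in> borel_measurable M"
  unfolding X_def by (rule borel_measurable_msmd[OF card Cf G]) (rule sample_measurable)

lemma Z_measurable [measurable]: "Z S k s \<in> borel_measurable M"
  unfolding Z_def by (rule borel_measurable_inner_iter[OF card Cf G X_measurable]) (rule sample_measurable)

lemma noisy_measurable [measurable]: "noisy S k s \<in> borel_measurable M"
  unfolding noisy_def
  by (rule borel_measurable_subproblem_grad[OF G X_measurable Z_measurable sample_measurable])

text \<open>\<open>(x\<^sub>k, z\<^sub>k\<^sub>,\<^sub>s)\<close> depends only on the samples that precede \<open>\<xi>\<^sub>k\<^sub>,\<^sub>s\<close> lexicographically.\<close>

lemma fresh_sample:
  "distr M borel (\<lambda>\<omega>. (X S k \<omega>, Z S k s \<omega>)) \<Otimes>\<^sub>M distr M Xi (\<xi> k s)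
    = distr M (borel \<Otimes>\<^sub>M Xi) (\<lambda>\<omega>. ((X S k \<omega>, Z S k s \<omega>), \<xi> k s \<omega>))"
proof -
  define A where "A = {(j, t). j < k \<or> j = k \<and> t < s}"
  define past where "past \<omega> = restrict (\<lambda>i. (case i of (k, s) \<Rightarrow> \<xi> k s) \<omega>) A" for \<omega>
  define x where "x p = msmd Cf \<gamma> (\<lambda>_. \<alpha>) r G x0 S (\<lambda>j t. p (j, t)) k" for p
  define h where "h p = (x p, inner_iter Cf \<gamma> G (x p) (\<lambda>t. p (k, t)) s)" for p
  let ?N = "PiM A (\<lambda>_. Xi)"
  have comp: "(\<lambda>p. p (j, t)) \<in> measurable ?N Xi" if "(j, t) \<in> A" for j t
    using that by (rule measurable_component_singleton)
  have x: "x \<in> borel_measurable ?N"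
    unfolding x_def by (rule borel_measurable_msmd[OF card Cf G]) (auto intro: comp simp: A_def)
  have "(\<lambda>p. inner_iter Cf \<gamma> G (x p) (\<lambda>t. p (k, t)) s) \<in> borel_measurable ?N"
    by (rule borel_measurable_inner_iter[OF card Cf G x]) (auto intro: comp simp: A_def)
  then have h: "h \<in> measurable ?N borel"
    unfolding h_def by (rule borel_measurable_Pair[OF x])
  let ?F = "PiM {(k, s)} (\<lambda>_. Xi)"
  define fresh where "fresh \<omega> = restrict (\<lambda>i. (case i of (k, s) \<Rightarrow> \<xi> k s) \<omega>) {(k, s)}" for \<omega>
  have c: "(\<lambda>p. p (k, s)) \<in> measurable ?F Xi"
    by (rule measurable_component_singleton) simp
  have "indep_var ?N past ?F fresh"
    \<comment> \<open>The index sets \<open>A\<close> and \<open>{(k, s)}\<close> are disjoint, so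
      the two groups of samples are independent.\<close>
    unfolding past_def[abs_def] fresh_def[abs_def] by (rule indep_var_restrict[OF indep]) (auto simp: A_def)
  then have pm: "past \<in> measurable M ?N" and fm: "fresh \<in> measurable M ?F"
    and joint: "distr M ?N past \<Otimes>\<^sub>M distr M ?F fresh = distr M (?N \<Otimes>\<^sub>M ?F) (\<lambda>\<omega>. (past \<omega>, fresh \<omega>))"
    unfolding indep_var_distribution_eq by blast+
  \<comment> \<open>Outside \<open>A\<close> the restricted family is \<open>undefined\<close>, but
    the iterates up to \<open>(k, s)\<close> never read those entries.\<close>
  have pX: "x (past \<omega>) = X S k \<omega>" for \<omega>
    unfolding x_def X_def by (rule msmd_cong) (simp add: past_def A_def)
  have pZ: "inner_iter Cf \<gamma> G (X S k \<omega>) (\<lambda>t. past \<omega> (k, t)) s = Z S k s \<omega>" for \<omega>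
    unfolding Z_def by (rule inner_iter_cong) (simp add: past_def A_def)
  have hp: "h (past \<omega>) = (X S k \<omega>, Z S k s \<omega>)" for \<omega>
    by (simp add: h_def pX pZ)
  have cf: "fresh \<omega> (k, s) = \<xi> k s \<omega>" for \<omega>
    by (simp add: fresh_def)
  have "distr M borel (\<lambda>\<omega>. (X S k \<omega>, Z S k s \<omega>)) = distr (distr M ?N past) borel h"
    by (subst distr_distr[OF h pm]) (simp add: comp_def hp)
  moreover have "distr M Xi (\<xi> k s) = distr (distr M ?F fresh) Xi (\<lambda>p. p (k, s))"
    by (subst distr_distr[OF c fm]) (simp add: comp_def cf)
  moreover have "distr (distr M ?N past) borel h \<Otimes>\<^sub>M distr (distr M ?F fresh) Xi (\<lambda>p. p (k, s))
      = distr (distr M ?N past \<Otimes>\<^sub>M distr M ?F fresh) (borel \<Otimes>\<^sub>M Xi) (\<lambda>(p, q). (h p, q (k, s)))"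
  proof (rule pair_measure_distr)
    show "sigma_finite_measure (distr (distr M ?F fresh) Xi (\<lambda>p. p (k, s)))"
      using c fm by (intro prob_space_imp_sigma_finite prob_space.prob_space_distr[OF prob_space_distr]) simp_all
  qed (use h c in simp_all)
  moreover have "distr (distr M (?N \<Otimes>\<^sub>M ?F) (\<lambda>\<omega>. (past \<omega>, fresh \<omega>))) (borel \<Otimes>\<^sub>M Xi) (\<lambda>(p, q). (h p, q (k, s)))
      = distr M (borel \<Otimes>\<^sub>M Xi) (\<lambda>\<omega>. ((X S k \<omega>, Z S k s \<omega>), \<xi> k s \<omega>))"
  proof (subst distr_distr)
    show "(\<lambda>(p, q). (h p, q (k, s))) \<in> measurable (?N \<Otimes>\<^sub>M ?F) (borel \<Otimes>\<^sub>M Xi)"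
      unfolding case_prod_beta
      by (intro measurable_Pair measurable_compose[OF measurable_fst h] measurable_compose[OF measurable_snd c])
    show "(\<lambda>\<omega>. (past \<omega>, fresh \<omega>)) \<in> measurable M (?N \<Otimes>\<^sub>M ?F)"
      by (rule measurable_Pair[OF pm fm])
  qed (simp add: comp_def hp cf)
  ultimately show ?thesis
    by (simp only: joint)
qed

lemma window_start_le: "window_start r S \<le> S"
  using r by (intro window_start_le_self) simp

lemma window_weight_pos: "0 < (\<Sum>s=window_start r S..S. \<gamma> s)"
  using window_start_le by (intro sum_pos) (auto simp: \<gamma>)

text \<open>The averaged direction lies in the ball of radius \<open>Cf\<close>, so a step has
  length at most \<open>\<alpha> * Cf\<close>. The bound is deterministic: continuous functions of
  \<open>x_k\<close> are bounded along the run and thus integrable.\<close>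

lemma X_bounded: "norm (X S k \<omega>) \<le> norm x0 + real k * (\<alpha> * Cf)"
proof (induction k)
  case 0
  show ?case by (simp add: X_def)
next
  case (Suc k)
  let ?w = "window_avg \<gamma> (window_start r (S k)) (S k) (\<lambda>s. fst (Z S k s \<omega>))"
  have "norm ?w \<le> Cf"
    using Z_Zset by (intro norm_window_avg_le window_weight_pos) (auto simp: Zset_iff less_imp_le \<gamma>)
  then have "norm (\<alpha> *\<^sub>R ?w) \<le> \<alpha> * Cf"
    using \<alpha>(1) by (simp add: mult_left_mono)
  then have "norm (X S (Suc k) \<omega>) \<le> norm (X S k \<omega>) + \<alpha> * Cf"
    unfolding X_Suc by (intro order_trans[OF norm_triangle_ineq] add_left_mono)
  then show ?case
    using Suc by (simp add: algebra_simps)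
qed

lemma Z_bounded: "norm (Z S k s \<omega>) \<le> Cf + real CARD('m)"
proof -
  have "norm (snd (Z S k s \<omega>)) \<le> (\<Sum>i\<in>UNIV. norm (snd (Z S k s \<omega>) $ i))"
    by (simp add: norm_le_l1_cart)
  also have "\<dots> \<le> real CARD('m)"
    using sum_bounded_above[of UNIV "\<lambda>i. norm (snd (Z S k s \<omega>) $ i)" 1]
      Z_Zset[of S k s \<omega>] Zset_weight_le_1[OF Z_Zset[of S k s \<omega>]] by (auto simp: Zset_iff)
  finally have "norm (snd (Z S k s \<omega>)) \<le> real CARD('m)" .
  moreover have "norm (Z S k s \<omega>) \<le> norm (fst (Z S k s \<omega>)) + norm (snd (Z S k s \<omega>))"
    using norm_Pair_le[of "fst (Z S k s \<omega>)" "snd (Z S k s \<omega>)"] by simp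
  ultimately show ?thesis
    using Z_Zset[of S k s \<omega>] by (auto simp: Zset_iff)
qed

lemma integrable_bounded_continuous:
  fixes W :: "'w \<Rightarrow> 'b::euclidean_space" and q :: "'b \<Rightarrow> real"
  assumes "W \<in> borel_measurable M" and "\<And>\<omega>. norm (W \<omega>) \<le> B" and q: "continuous_on UNIV q"
  shows "integrable M (\<lambda>\<omega>. q (W \<omega>))"
proof -
  have "compact (q ` cball 0 B)"
    using q by (intro compact_continuous_image) (auto elim: continuous_on_subset)
  then have "bounded (q ` cball 0 B)"
    by (rule compact_imp_bounded)
  then obtain b where "\<forall>t\<in>q ` cball 0 B. norm t \<le> b"
    unfolding bounded_iff by blast
  then have b: "\<And>w. w \<in> cball 0 B \<Longrightarrow> norm (q w) \<le> b"
    by blast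
  show ?thesis
  proof (rule integrable_const_bound)
    show "AE \<omega> in M. norm (q (W \<omega>)) \<le> b"
      using assms(2) by (intro AE_I2 b) simp
    show "(\<lambda>\<omega>. q (W \<omega>)) \<in> borel_measurable M"
      by (rule borel_measurable_continuous_on[OF q assms(1)])
  qed
qed

lemma integrable_X: "continuous_on UNIV q \<Longrightarrow> integrable M (\<lambda>\<omega>. q (X S k \<omega>) :: real)"
  by (rule integrable_bounded_continuous[OF X_measurable X_bounded])

lemma integrable_XZ:
  fixes q :: "_ \<Rightarrow> real"
  assumes "continuous_on UNIV q"
  shows "integrable M (\<lambda>\<omega>. q (X S k \<omega>, Z S k s \<omega>))"
proof (rule integrable_bounded_continuous[OF _ _ assms])
  show "(\<lambda>\<omega>. (X S k \<omega>, Z S k s \<omega>)) \<in> borel_measurable M"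
    by (intro borel_measurable_Pair X_measurable Z_measurable)
  show "norm (X S k \<omega>, Z S k s \<omega>) \<le> (norm x0 + real k * (\<alpha> * Cf)) + (Cf + real CARD('m))" for \<omega>
    by (intro order_trans[OF norm_Pair_le] add_mono X_bounded Z_bounded)
qed

lemma continuous_grad: "continuous_on UNIV (grad (f i))"
  by (rule lipschitz_on_continuous_on[OF lip])

lemma continuous_dirn: "continuous_on UNIV dirn"
  unfolding dirn_def[abs_def] by (rule continuous_common_descent) (rule continuous_grad)

lemma continuous_f: "continuous_on UNIV (f i)"
  by (simp add: continuous_on_eq_continuous_at differentiable_imp_continuous_within diff)

end

section \<open>Moments of the stochastic subproblem gradient\<close>

lemma norm_subproblem_grad_le:
  fixes G :: "'m::finite \<Rightarrow> real^'n \<Rightarrow> 'xi \<Rightarrow> real^'n"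
  assumes z: "z \<in> Zset Cf"
  shows "(norm (subproblem_grad G x z y))\<^sup>2
    \<le> 2 * Cf\<^sup>2 + (2 * real CARD('m) + Cf\<^sup>2) * (\<Sum>i\<in>UNIV. (norm (G i x y))\<^sup>2)"
proof -
  let ?g = "\<lambda>i. G i x y" and ?d = "fst z" and ?l = "snd z"
  let ?Q = "\<Sum>i\<in>UNIV. (norm (?g i))\<^sup>2"
  have d: "norm ?d \<le> Cf" using z by (simp add: Zset_iff)
  have d2: "(norm ?d)\<^sup>2 \<le> Cf\<^sup>2"
    using d by (intro power_mono) auto
  have "norm (\<Sum>i\<in>UNIV. ?l $ i *\<^sub>R ?g i) \<le> (\<Sum>i\<in>UNIV. norm (?g i))"
  proof (rule sum_norm_le)
    fix i
    have "\<bar>?l $ i\<bar> * norm (?g i) \<le> 1 * norm (?g i)"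
      using z Zset_weight_le_1[OF z, of i] by (intro mult_right_mono) (auto simp: Zset_iff)
    then show "norm (?l $ i *\<^sub>R ?g i) \<le> norm (?g i)" by simp
  qed
  then have "(norm (\<Sum>i\<in>UNIV. ?l $ i *\<^sub>R ?g i))\<^sup>2 \<le> (\<Sum>i\<in>UNIV. norm (?g i))\<^sup>2"
    by (intro power_mono) auto
  also have "\<dots> \<le> real CARD('m) * ?Q"
    using sum_squared_le_sum_of_squares[of "\<lambda>i. norm (?g i)" UNIV] by (simp add: mult.commute)
  finally have 1: "(norm (\<Sum>i\<in>UNIV. ?l $ i *\<^sub>R ?g i))\<^sup>2 \<le> real CARD('m) * ?Q" .
  have par: "(norm (a + b))\<^sup>2 \<le> 2 * (norm a)\<^sup>2 + 2 * (norm b)\<^sup>2" for a b :: "real^'n"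
  proof -
    have "0 \<le> (norm (a - b))\<^sup>2" by simp
    then show ?thesis
      unfolding power2_norm_eq_inner inner_add_left inner_add_right inner_diff_left inner_diff_right
        inner_commute[of b a] by argo
  qed
  have 2: "(norm (fst (subproblem_grad G x z y)))\<^sup>2 \<le> 2 * (real CARD('m) * ?Q) + 2 * Cf\<^sup>2"
    using par[of "\<Sum>i\<in>UNIV. ?l $ i *\<^sub>R ?g i" ?d] 1 d2 by (simp add: subproblem_grad_def)
  have "(norm (snd (subproblem_grad G x z y)))\<^sup>2 = (\<Sum>i\<in>UNIV. (?g i \<bullet> ?d)\<^sup>2)"
    by (simp add: subproblem_grad_def norm_vec_sq)
  also have "\<dots> \<le> (\<Sum>i\<in>UNIV. Cf\<^sup>2 * (norm (?g i))\<^sup>2)"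
  proof (rule sum_mono)
    fix i
    have "\<bar>?g i \<bullet> ?d\<bar> \<le> norm (?g i) * norm ?d"
      by (rule Cauchy_Schwarz_ineq2)
    also have "\<dots> \<le> norm (?g i) * Cf"
      using d by (rule mult_left_mono) simp
    finally have "\<bar>?g i \<bullet> ?d\<bar>\<^sup>2 \<le> (norm (?g i) * Cf)\<^sup>2"
      by (intro power_mono) auto
    then show "(?g i \<bullet> ?d)\<^sup>2 \<le> Cf\<^sup>2 * (norm (?g i))\<^sup>2"
      by (simp add: power_mult_distrib mult.commute)
  qed
  also have "\<dots> = Cf\<^sup>2 * ?Q"
    by (simp add: sum_distrib_left)
  finally have 3: "(norm (snd (subproblem_grad G x z y)))\<^sup>2 \<le> Cf\<^sup>2 * ?Q" .
  show ?thesis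
    using 2 3 unfolding norm_prod_sq[of "subproblem_grad G x z y"] distrib_right by linarith
qed

lemma has_bochner_integral_subproblem_grad:
  fixes G :: "'m::finite \<Rightarrow> real^'n \<Rightarrow> 'xi \<Rightarrow> real^'n"
  assumes "prob_space Xi" and g: "\<And>i. has_bochner_integral Xi (G i x) (g i)"
  shows "has_bochner_integral Xi (\<lambda>y. subproblem_grad G x z y \<bullet> v) (mean_field g z \<bullet> v)"
proof -
  interpret prob_space Xi by fact
  have c: "has_bochner_integral Xi (\<lambda>y. c) c" for c :: real
    using has_bochner_integral_integrable[OF integrable_const[of c]] by (simp add: prob_space)
  have "has_bochner_integral Xi
     (\<lambda>y. ((\<Sum>i\<in>UNIV. snd z $ i * (G i x y \<bullet> fst v)) + fst z \<bullet> fst v)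
         - (\<Sum>i\<in>UNIV. (G i x y \<bullet> fst z) * snd v $ i))
     (((\<Sum>i\<in>UNIV. snd z $ i * (g i \<bullet> fst v)) + fst z \<bullet> fst v)
         - (\<Sum>i\<in>UNIV. (g i \<bullet> fst z) * snd v $ i))"
    by (intro has_bochner_integral_diff has_bochner_integral_add has_bochner_integral_sum c
        has_bochner_integral_mult_right has_bochner_integral_mult_left
        has_bochner_integral_inner_left g)
  moreover have "(\<lambda>y. subproblem_grad G x z y \<bullet> v) =
     (\<lambda>y. ((\<Sum>i\<in>UNIV. snd z $ i * (G i x y \<bullet> fst v)) + fst z \<bullet> fst v)
         - (\<Sum>i\<in>UNIV. (G i x y \<bullet> fst z) * snd v $ i))"
    by (rule ext) (simp add: subproblem_grad_def inner_prod_def inner_add_left inner_sum_left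
        inner_vec_def[of "\<chi> i. _ i"] sum_negf)
  moreover have "mean_field g z \<bullet> v = ((\<Sum>i\<in>UNIV. snd z $ i * (g i \<bullet> fst v)) + fst z \<bullet> fst v)
         - (\<Sum>i\<in>UNIV. (g i \<bullet> fst z) * snd v $ i)"
    by (simp add: mean_field_def inner_prod_def inner_add_left inner_sum_left
        inner_vec_def[of "\<chi> i. _ i"] sum_negf)
  ultimately show ?thesis by (simp only:)
qed

context msmd_run
begin

text \<open>Jensen's inequality for the squared norm, obtained by integrating
  \<open>G i x y \<bullet> ?g\<close> and applying Young's inequality, which leaves half of the
  squared norm of \<open>?g\<close> to absorb.\<close>

lemma grad_bound:
  assumes "oracle_at f G Xi Cf \<delta> x"
  shows "norm (grad (f i) x) \<le> Cf"
proof -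
  interpret Xi: prob_space Xi by (rule Xi)
  let ?g = "grad (f i) x"
  have hb: "has_bochner_integral Xi (G i x) ?g"
    and nn: "(\<integral>\<^sup>+y. ennreal ((norm (G i x y))\<^sup>2) \<partial>Xi) \<le> ennreal (Cf\<^sup>2)"
    using assms by (auto simp: oracle_at_def)
  have m: "G i x \<in> borel_measurable Xi"
    using hb by (rule borel_measurable_has_bochner_integral)
  have int: "integrable Xi (\<lambda>y. (norm (G i x y))\<^sup>2)"
    using nn m by (intro integrableI_nonneg) (auto intro: le_less_trans)
  have "ennreal (\<integral>y. (norm (G i x y))\<^sup>2 \<partial>Xi) \<le> ennreal (Cf\<^sup>2)"
    using nn nn_integral_eq_integral[OF int] by simp
  then have sq: "(\<integral>y. (norm (G i x y))\<^sup>2 \<partial>Xi) \<le> Cf\<^sup>2"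
    by (simp add: ennreal_le_iff)
  have hb': "has_bochner_integral Xi (\<lambda>y. G i x y \<bullet> ?g) (?g \<bullet> ?g)"
    by (intro has_bochner_integral_inner_left hb)
  have "?g \<bullet> ?g = (\<integral>y. G i x y \<bullet> ?g \<partial>Xi)"
    using has_bochner_integral_integral_eq[OF hb'] by simp
  also have "\<dots> \<le> (\<integral>y. ((norm (G i x y))\<^sup>2 + (norm ?g)\<^sup>2) / 2 \<partial>Xi)"
  proof (rule integral_mono)
    show "integrable Xi (\<lambda>y. G i x y \<bullet> ?g)"
      using hb' by (rule integrable.intros)
    show "integrable Xi (\<lambda>y. ((norm (G i x y))\<^sup>2 + (norm ?g)\<^sup>2) / 2)"
      using int by simp
    fix y
    have "0 \<le> (norm (G i x y - ?g))\<^sup>2" by simp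
    then show "G i x y \<bullet> ?g \<le> ((norm (G i x y))\<^sup>2 + (norm ?g)\<^sup>2) / 2"
      unfolding power2_norm_eq_inner inner_diff_left inner_diff_right inner_commute[of ?g "G i x y"] by argo
  qed
  also have "\<dots> = ((\<integral>y. (norm (G i x y))\<^sup>2 \<partial>Xi) + (norm ?g)\<^sup>2) / 2"
    using int by (simp add: Xi.prob_space)
  finally have "(norm ?g)\<^sup>2 \<le> Cf\<^sup>2"
    using sq unfolding power2_norm_eq_inner by argo
  then show ?thesis
    using Cf by (simp add: power2_le_iff_abs_le)
qed

lemma dirn_bound:
  assumes "oracle_at f G Xi Cf \<delta> x"
  shows "norm (dirn x) \<le> Cf"
  unfolding dirn_def
  by (rule order_trans[OF norm_common_descent_le grad_bound[OF assms]])

lemma G_second_moment: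
  assumes "AE \<omega> in M. oracle_at f G Xi Cf \<delta> (X S k \<omega>)"
  shows "integrable M (\<lambda>\<omega>. (norm (G i (X S k \<omega>) (\<xi> k s \<omega>)))\<^sup>2)"
    and "(\<integral>\<omega>. (norm (G i (X S k \<omega>) (\<xi> k s \<omega>)))\<^sup>2 \<partial>M) \<le> Cf\<^sup>2"
proof -
  let ?g = "\<lambda>w :: ((real^'n) \<times> (real^'n) \<times> (real^'m)) \<times> 'xi. ennreal ((norm (G i (fst (fst w)) (snd w)))\<^sup>2)"
  have [measurable]: "(\<lambda>w :: ((real^'n) \<times> (real^'n) \<times> (real^'m)) \<times> 'xi. G i (fst (fst w)) (snd w)) \<in> borel_measurable (borel \<Otimes>\<^sub>M Xi)"
    using measurable_compose[OF measurable_Pair[OF borel_measurable_fst'[OF measurable_fst] measurable_snd] G[of i]]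
    by simp
  then have g: "?g \<in> borel_measurable (borel \<Otimes>\<^sub>M Xi)"
    by measurable
  have m: "(\<lambda>\<omega>. G i (X S k \<omega>) (\<xi> k s \<omega>)) \<in> borel_measurable M"
    using measurable_compose[OF measurable_Pair[OF X_measurable sample_measurable] G[of i]] by simp
  have "(\<integral>\<^sup>+\<omega>. ?g ((X S k \<omega>, Z S k s \<omega>), \<xi> k s \<omega>) \<partial>M)
      = (\<integral>\<^sup>+\<omega>. (\<integral>\<^sup>+y. ?g ((X S k \<omega>, Z S k s \<omega>), y) \<partial>distr M Xi (\<xi> k s)) \<partial>M)"
    by (rule nn_integral_fresh[OF _ sample_measurable fresh_sample g])
       (intro borel_measurable_Pair X_measurable Z_measurable)
  also have "\<dots> \<le> (\<integral>\<^sup>+\<omega>. ennreal (Cf\<^sup>2) \<partial>M)"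
    unfolding distr using assms by (intro nn_integral_mono_AE) (auto simp: oracle_at_def elim!: eventually_mono)
  also have "\<dots> = ennreal (Cf\<^sup>2)"
    by (simp add: emeasure_space_1)
  finally have nn: "(\<integral>\<^sup>+\<omega>. ennreal ((norm (G i (X S k \<omega>) (\<xi> k s \<omega>)))\<^sup>2) \<partial>M) \<le> ennreal (Cf\<^sup>2)"
    by simp
  show int: "integrable M (\<lambda>\<omega>. (norm (G i (X S k \<omega>) (\<xi> k s \<omega>)))\<^sup>2)"
    using nn m by (intro integrableI_nonneg) (auto intro: le_less_trans)
  show "(\<integral>\<omega>. (norm (G i (X S k \<omega>) (\<xi> k s \<omega>)))\<^sup>2 \<partial>M) \<le> Cf\<^sup>2"
    using nn nn_integral_eq_integral[OF int] by (simp add: ennreal_le_iff)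
qed

text \<open>The bound of \<open>norm_subproblem_grad_le\<close> with each of the m squared norms
  replaced by its mean bound \<open>Cf\<^sup>2\<close>. It takes the place of the square of
  \<open>M_star\<close>, the difference going into the final constant.\<close>

definition noise_bound :: real where
  "noise_bound = 2 * Cf\<^sup>2 + (2 * real CARD('m) + Cf\<^sup>2) * (real CARD('m) * Cf\<^sup>2)"

lemma noisy_second_moment:
  assumes "AE \<omega> in M. oracle_at f G Xi Cf \<delta> (X S k \<omega>)"
  shows "integrable M (\<lambda>\<omega>. (norm (noisy S k s \<omega>))\<^sup>2)"
    and "(\<integral>\<omega>. (norm (noisy S k s \<omega>))\<^sup>2 \<partial>M) \<le> noise_bound"
proof -
  let ?h = "\<lambda>\<omega>. 2 * Cf\<^sup>2 + (2 * real CARD('m) + Cf\<^sup>2) *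
    (\<Sum>i\<in>UNIV. (norm (G i (X S k \<omega>) (\<xi> k s \<omega>)))\<^sup>2)"
  have le: "(norm (noisy S k s \<omega>))\<^sup>2 \<le> ?h \<omega>" for \<omega>
    unfolding noisy_def by (rule norm_subproblem_grad_le[OF Z_Zset])
  have h: "integrable M ?h"
    by (intro Bochner_Integration.integrable_add integrable_const integrable_mult_right
        Bochner_Integration.integrable_sum G_second_moment(1)[OF assms])
  show int: "integrable M (\<lambda>\<omega>. (norm (noisy S k s \<omega>))\<^sup>2)"
  proof (rule Bochner_Integration.integrable_bound[OF h])
    show "AE \<omega> in M. norm ((norm (noisy S k s \<omega>))\<^sup>2) \<le> norm (?h \<omega>)"
      using order_trans[OF le abs_ge_self] by (intro AE_I2) simp
  qed measurable
  have "(\<integral>\<omega>. (norm (noisy S k s \<omega>))\<^sup>2 \<partial>M) \<le> (\<integral>\<omega>. ?h \<omega> \<partial>M)"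
    by (rule integral_mono[OF int h le])
  also have "\<dots> = 2 * Cf\<^sup>2 + (2 * real CARD('m) + Cf\<^sup>2) *
      (\<Sum>i\<in>UNIV. \<integral>\<omega>. (norm (G i (X S k \<omega>) (\<xi> k s \<omega>)))\<^sup>2 \<partial>M)"
    using G_second_moment(1)[OF assms] by (simp add: prob_space)
  also have "\<dots> \<le> noise_bound"
    unfolding noise_bound_def
  proof (intro add_left_mono mult_left_mono)
    show "(\<Sum>i\<in>UNIV. \<integral>\<omega>. (norm (G i (X S k \<omega>) (\<xi> k s \<omega>)))\<^sup>2 \<partial>M) \<le> real CARD('m) * Cf\<^sup>2"
      using sum_bounded_above[of "UNIV :: 'm set", OF G_second_moment(2)[OF assms]] by simp
  qed simp
  finally show "(\<integral>\<omega>. (norm (noisy S k s \<omega>))\<^sup>2 \<partial>M) \<le> noise_bound" .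
qed

definition target :: "'m \<Rightarrow> real^'n \<Rightarrow> (real^'n) \<times> (real^'m)" where
  "target i x = (dirn x, axis i 1)"

lemma continuous_target: "continuous_on UNIV (target i)"
  unfolding target_def[abs_def] by (intro continuous_intros continuous_dirn)

text \<open>Both \<open>Z S k s\<close> and the target are determined by the past, so integrating
  out the fresh sample acts on the noisy gradient alone. Square integrability of the two factors
  justifies the exchange.\<close>

lemma noisy_mean:
  assumes "AE \<omega> in M. oracle_at f G Xi Cf \<delta> (X S k \<omega>)"
  shows "integrable M (\<lambda>\<omega>. noisy S k s \<omega> \<bullet> (Z S k s \<omega> - target i (X S k \<omega>)))"
    and "(\<integral>\<omega>. noisy S k s \<omega> \<bullet> (Z S k s \<omega> - target i (X S k \<omega>)) \<partial>M)
      = (\<integral>\<omega>. mean_field (\<lambda>i. grad (f i) (X S k \<omega>)) (Z S k s \<omega>) \<bullet> (Z S k s \<omega> - target i (X S k \<omega>)) \<partial>M)"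
proof -
  have tX: "(\<lambda>\<omega>. target i (X S k \<omega>)) \<in> borel_measurable M"
    by (rule borel_measurable_continuous_on[OF continuous_target X_measurable])
  have "continuous_on UNIV (\<lambda>w. (norm (snd w - target i (fst w)))\<^sup>2)"
    by (intro continuous_intros continuous_on_compose2[OF continuous_target]) auto
  from integrable_XZ[OF this]
  have "integrable M (\<lambda>\<omega>. (norm (Z S k s \<omega> - target i (X S k \<omega>)))\<^sup>2)"
    by simp
  then have bd: "integrable M (\<lambda>\<omega>. (norm (noisy S k s \<omega>))\<^sup>2 + (norm (Z S k s \<omega> - target i (X S k \<omega>)))\<^sup>2)"
    by (intro Bochner_Integration.integrable_add noisy_second_moment(1)[OF assms])
  show int: "integrable M (\<lambda>\<omega>. noisy S k s \<omega> \<bullet> (Z S k s \<omega> - target i (X S k \<omega>)))"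
  proof (rule Bochner_Integration.integrable_bound[OF bd])
    show "(\<lambda>\<omega>. noisy S k s \<omega> \<bullet> (Z S k s \<omega> - target i (X S k \<omega>))) \<in> borel_measurable M"
      using tX by measurable
    have "\<bar>a \<bullet> b\<bar> \<le> (norm a)\<^sup>2 + (norm b)\<^sup>2" for a b :: "(real^'n) \<times> (real^'m)"
    proof -
      have "\<bar>a \<bullet> b\<bar> \<le> norm a * norm b" by (rule Cauchy_Schwarz_ineq2)
      also have "\<dots> \<le> (norm a)\<^sup>2 + (norm b)\<^sup>2"
        using sum_squares_bound[of "norm a" "norm b"] mult_nonneg_nonneg[OF norm_ge_zero[of a] norm_ge_zero[of b]]
        by linarith
      finally show ?thesis .
    qed
    then show "AE \<omega> in M. norm (noisy S k s \<omega> \<bullet> (Z S k s \<omega> - target i (X S k \<omega>)))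
        \<le> norm ((norm (noisy S k s \<omega>))\<^sup>2 + (norm (Z S k s \<omega> - target i (X S k \<omega>)))\<^sup>2)"
      by simp
  qed
  let ?g = "\<lambda>w. subproblem_grad G (fst (fst w)) (snd (fst w)) (snd w) \<bullet> (snd (fst w) - target i (fst (fst w)))"
  have x: "(\<lambda>w. fst (fst w)) \<in> borel_measurable ((borel :: (_ \<times> (real^'n) \<times> (real^'m)) measure) \<Otimes>\<^sub>M Xi)"
    by (rule borel_measurable_fst'[OF measurable_fst])
  have z: "(\<lambda>w. snd (fst w)) \<in> borel_measurable ((borel :: ((real^'n) \<times> (real^'n) \<times> (real^'m)) measure) \<Otimes>\<^sub>M Xi)"
    by (rule borel_measurable_snd'[OF measurable_fst])
  have g: "?g \<in> borel_measurable (borel \<Otimes>\<^sub>M Xi)"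
    by (intro borel_measurable_inner borel_measurable_diff borel_measurable_subproblem_grad[OF G x z]
        borel_measurable_continuous_on[OF continuous_target x] z measurable_snd)
  have "(\<integral>\<omega>. ?g ((X S k \<omega>, Z S k s \<omega>), \<xi> k s \<omega>) \<partial>M)
      = (\<integral>\<omega>. (\<integral>y. ?g ((X S k \<omega>, Z S k s \<omega>), y) \<partial>distr M Xi (\<xi> k s)) \<partial>M)"
  proof (rule integral_fresh[OF _ sample_measurable fresh_sample g])
    show "(\<lambda>\<omega>. (X S k \<omega>, Z S k s \<omega>)) \<in> borel_measurable M"
      by (intro borel_measurable_Pair X_measurable Z_measurable)
    show "integrable M (\<lambda>\<omega>. ?g ((X S k \<omega>, Z S k s \<omega>), \<xi> k s \<omega>))"
      using int by (simp add: noisy_def)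
  qed
  also have "\<dots> = (\<integral>\<omega>. mean_field (\<lambda>i. grad (f i) (X S k \<omega>)) (Z S k s \<omega>) \<bullet> (Z S k s \<omega> - target i (X S k \<omega>)) \<partial>M)"
    unfolding distr
  proof (rule integral_cong_AE)
    show eq: "AE \<omega> in M. (\<integral>y. ?g ((X S k \<omega>, Z S k s \<omega>), y) \<partial>Xi)
      = mean_field (\<lambda>i. grad (f i) (X S k \<omega>)) (Z S k s \<omega>) \<bullet> (Z S k s \<omega> - target i (X S k \<omega>))"
      using assms
    proof eventually_elim
      case (elim \<omega>)
      show ?case
        unfolding fst_conv snd_conv
        by (rule has_bochner_integral_integral_eq, rule has_bochner_integral_subproblem_grad[OF Xi])
           (use elim in \<open>simp add: oracle_at_def\<close>)
    qed
    have gi: "(\<lambda>\<omega>. grad (f j) (X S k \<omega>)) \<in> borel_measurable M" for j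
      by (rule borel_measurable_continuous_on[OF continuous_grad X_measurable])
    have "(\<lambda>\<omega>. mean_field (\<lambda>i. grad (f i) (X S k \<omega>)) (Z S k s \<omega>)) \<in> borel_measurable M"
      unfolding mean_field_def
      by (intro borel_measurable_Pair borel_measurable_add borel_measurable_sum borel_measurable_scaleR
          borel_measurable_vec_lambda borel_measurable_uminus borel_measurable_inner
          borel_measurable_component borel_measurable_snd' borel_measurable_fst' Z_measurable gi)
    then show "(\<lambda>\<omega>. mean_field (\<lambda>i. grad (f i) (X S k \<omega>)) (Z S k s \<omega>) \<bullet> (Z S k s \<omega> - target i (X S k \<omega>)))
        \<in> borel_measurable M"
      using tX by measurable
    \<comment> \<open>The oracle identity holds only almost everywhere, so measurability of the
      inner integral has to be shown separately for \<open>integral_cong_AE\<close>.\<close>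
    have "(\<lambda>w. \<integral>y. ?g (w, y) \<partial>Xi) \<in> borel_measurable borel"
      using sigma_finite_measure.borel_measurable_lebesgue_integral[OF prob_space_imp_sigma_finite[OF Xi],
          of "\<lambda>w y. ?g (w, y)"] g by simp
    from measurable_compose[OF _ this, of "\<lambda>\<omega>. (X S k \<omega>, Z S k s \<omega>)" M]
    show "(\<lambda>\<omega>. \<integral>y. ?g ((X S k \<omega>, Z S k s \<omega>), y) \<partial>Xi) \<in> borel_measurable M"
      by (simp add: borel_measurable_Pair X_measurable Z_measurable)
  qed
  finally show "(\<integral>\<omega>. noisy S k s \<omega> \<bullet> (Z S k s \<omega> - target i (X S k \<omega>)) \<partial>M)
      = (\<integral>\<omega>. mean_field (\<lambda>i. grad (f i) (X S k \<omega>)) (Z S k s \<omega>) \<bullet> (Z S k s \<omega> - target i (X S k \<omega>)) \<partial>M)"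
    by (simp add: noisy_def)
qed

section \<open>Regret of the inner loop and one outer iteration\<close>

definition \<kappa> :: real where "\<kappa> = kappa Cf CARD('m)"

lemma \<kappa>_pos: "0 < \<kappa>"
  unfolding \<kappa>_def by (rule kappa_pos[OF Cf card])

lemma inner_step_bound:
  assumes u: "u \<in> Zset Cf"
  shows "\<gamma> s * (noisy S k s \<omega> \<bullet> (Z S k s \<omega> - u))
    \<le> bregman Cf (Z S k s \<omega>) u - bregman Cf (Z S k (Suc s) \<omega>) u
      + (\<gamma> s)\<^sup>2 * (norm (noisy S k s \<omega>))\<^sup>2 / (4 * \<kappa>)"
  using prox_step[OF card Cf Z_Zint u, of "\<gamma> s *\<^sub>R noisy S k s \<omega>" S k s \<omega>]
  by (simp add: Z_Suc[symmetric] \<kappa>_def[symmetric] power_mult_distrib)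

text \<open>The Bregman terms cancel except at the two ends of the window. A window ending at
  \<open>n = S\<close> involves the iterate after the last one of the method, driven by the sample
  with index \<open>S\<close>; it exists because samples are indexed by all naturals, and its
  nonnegative Bregman distance is later dropped.\<close>

lemma telescope:
  assumes u: "u \<in> Zset Cf" and "P \<le> n"
  shows "(\<Sum>s=P..n. \<gamma> s * (noisy S k s \<omega> \<bullet> (Z S k s \<omega> - u)))
    \<le> bregman Cf (Z S k P \<omega>) u - bregman Cf (Z S k (Suc n) \<omega>) u
      + (\<Sum>s=P..n. (\<gamma> s)\<^sup>2 * (norm (noisy S k s \<omega>))\<^sup>2 / (4 * \<kappa>))"
  using \<open>P \<le> n\<close>
proof (induction n rule: dec_induct)
  case base
  show ?case using inner_step_bound[OF u, of P S k \<omega>] by simp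
next
  case (step n)
  have last: "(\<Sum>s=P..Suc n. h s) = (\<Sum>s=P..n. h s) + h (Suc n)" for h :: "nat \<Rightarrow> real"
    using \<open>P \<le> n\<close> by simp
  show ?case
    unfolding last using step.IH inner_step_bound[OF u, of "Suc n" S k \<omega>] by linarith
qed

lemma bregman_Z_nonneg: "u \<in> Zset Cf \<Longrightarrow> 0 \<le> bregman Cf (Z S k s \<omega>) u"
  using order_trans[OF _ bregman_lower[OF card Cf Z_Zint, of u S k s \<omega>]] kappa_pos[OF Cf card]
  by simp

lemma target_Zset:
  assumes "oracle_at f G Xi Cf \<delta> x"
  shows "target i x \<in> Zset Cf"
  using dirn_bound[OF assms] by (auto simp: Zset_iff target_def axis_def)

lemma outer_step:
  fixes i :: 'm and S :: "nat \<Rightarrow> nat"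
  defines "P k \<equiv> window_start r (S k)"
  assumes orac: "AE \<omega> in M. oracle_at f G Xi Cf \<delta> (X S k \<omega>)"
    and breg: "AE \<omega> in M. \<forall>u\<in>Zset Cf. bregman Cf (Z S k (P k) \<omega>) u \<le> B"
  shows "\<alpha> / 2 * (\<integral>\<omega>. (norm (dirn (X S k \<omega>)))\<^sup>2 \<partial>M)
    \<le> (\<integral>\<omega>. f i (X S k \<omega>) \<partial>M) - (\<integral>\<omega>. f i (X S (Suc k) \<omega>) \<partial>M)
      + \<alpha> * ((B + noise_bound / (4 * \<kappa>) * (\<Sum>s=P k..S k. (\<gamma> s)\<^sup>2)) / (\<Sum>s=P k..S k. \<gamma> s))"
proof -
  let ?I = "{P k..S k}"
  let ?\<Gamma> = "\<Sum>s\<in>?I. \<gamma> s"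
  define R where "R = B + noise_bound / (4 * \<kappa>) * (\<Sum>s\<in>?I. (\<gamma> s)\<^sup>2)"
  define g where "g x = (\<lambda>i. grad (f i) x)" for x
  define noise where "noise s \<omega> = noisy S k s \<omega> \<bullet> (Z S k s \<omega> - target i (X S k \<omega>))" for s \<omega>
  define drift where "drift s \<omega> = mean_field (g (X S k \<omega>)) (Z S k s \<omega>) \<bullet> (Z S k s \<omega> - target i (X S k \<omega>))" for s \<omega>
  define low where "low s \<omega> = grad (f i) (X S k \<omega>) \<bullet> fst (Z S k s \<omega>) + (norm (fst (Z S k s \<omega>)))\<^sup>2 / 2
      + (norm (dirn (X S k \<omega>)))\<^sup>2 / 2" for s \<omega>
  have \<Gamma>: "0 < ?\<Gamma>" unfolding P_def by (rule window_weight_pos)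
  have PS: "P k \<le> S k" unfolding P_def by (rule window_start_le)
  have int_noise: "integrable M (noise s)"
    and mean: "(\<integral>\<omega>. noise s \<omega> \<partial>M) = (\<integral>\<omega>. drift s \<omega> \<partial>M)" for s
    unfolding noise_def[abs_def] drift_def g_def using noisy_mean[OF orac] by simp_all
  have int_sq: "integrable M (\<lambda>\<omega>. (norm (noisy S k s \<omega>))\<^sup>2)"
    and le_sq: "(\<integral>\<omega>. (norm (noisy S k s \<omega>))\<^sup>2 \<partial>M) \<le> noise_bound" for s
    using noisy_second_moment[OF orac] by simp_all
  have int_drift: "integrable M (drift s)" for s
  proof -
    have "continuous_on UNIV (\<lambda>w. mean_field (g (fst w)) (snd w) \<bullet> (snd w - target i (fst w)))"
      unfolding mean_field_def g_def
      by (intro continuous_intros continuous_on_compose2[OF continuous_grad]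
          continuous_on_compose2[OF continuous_target]) auto
    from integrable_XZ[OF this, of S k s] show ?thesis
      by (simp add: drift_def[abs_def])
  qed
  have int_low: "integrable M (low s)" for s
  proof -
    have "continuous_on UNIV (\<lambda>w. grad (f i) (fst w) \<bullet> fst (snd w :: (real^'n) \<times> (real^'m)) + (norm (fst (snd w)))\<^sup>2 / 2
      + (norm (dirn (fst w)))\<^sup>2 / 2)"
      by (intro continuous_intros continuous_on_compose2[OF continuous_grad]
          continuous_on_compose2[OF continuous_dirn]) auto
    from integrable_XZ[OF this, of S k s] show ?thesis
      by (simp add: low_def[abs_def])
  qed
  have int_f: "integrable M (\<lambda>\<omega>. f i (X S l \<omega>))" for l
    by (rule integrable_X[OF continuous_f])
  have int_d: "integrable M (\<lambda>\<omega>. (norm (dirn (X S k \<omega>)))\<^sup>2)"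
    by (rule integrable_X) (intro continuous_intros continuous_dirn)
  have "(\<Sum>s\<in>?I. \<gamma> s * (\<integral>\<omega>. noise s \<omega> \<partial>M)) = (\<integral>\<omega>. (\<Sum>s\<in>?I. \<gamma> s * noise s \<omega>) \<partial>M)"
    using int_noise by simp
  also have "\<dots> \<le> (\<integral>\<omega>. B + (\<Sum>s\<in>?I. (\<gamma> s)\<^sup>2 * (norm (noisy S k s \<omega>))\<^sup>2 / (4 * \<kappa>)) \<partial>M)"
  proof (rule integral_mono_AE)
    show "integrable M (\<lambda>\<omega>. \<Sum>s\<in>?I. \<gamma> s * noise s \<omega>)"
      using int_noise by simp
    show "integrable M (\<lambda>\<omega>. B + (\<Sum>s\<in>?I. (\<gamma> s)\<^sup>2 * (norm (noisy S k s \<omega>))\<^sup>2 / (4 * \<kappa>)))"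
      using int_sq by simp
    show "AE \<omega> in M. (\<Sum>s\<in>?I. \<gamma> s * noise s \<omega>) \<le> B + (\<Sum>s\<in>?I. (\<gamma> s)\<^sup>2 * (norm (noisy S k s \<omega>))\<^sup>2 / (4 * \<kappa>))"
      using orac breg
    proof eventually_elim
      case (elim \<omega>)
      \<comment> \<open>The target varies with \<open>\<omega>\<close>, but the telescoped bound is
        pathwise and \<open>breg\<close> is uniform in \<open>u\<close>, so it may be inserted for
        each \<open>\<omega>\<close> separately.\<close>
      have u: "target i (X S k \<omega>) \<in> Zset Cf"
        using elim(1) by (rule target_Zset)
      have "bregman Cf (Z S k (P k) \<omega>) (target i (X S k \<omega>)) \<le> B"
        using elim(2) u by blast
      then show ?case
        using telescope[OF u PS, of S k \<omega>] bregman_Z_nonneg[OF u, of S k "Suc (S k)" \<omega>]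
        unfolding noise_def by linarith
    qed
  qed
  also have "\<dots> = B + (\<Sum>s\<in>?I. (\<gamma> s)\<^sup>2 * (\<integral>\<omega>. (norm (noisy S k s \<omega>))\<^sup>2 \<partial>M) / (4 * \<kappa>))"
    using int_sq by (simp add: prob_space)
  also have "\<dots> \<le> B + (\<Sum>s\<in>?I. (\<gamma> s)\<^sup>2 * noise_bound / (4 * \<kappa>))"
    using \<kappa>_pos le_sq by (intro add_left_mono sum_mono divide_right_mono mult_left_mono) auto
  also have "\<dots> = R"
    by (simp add: R_def sum_distrib_left mult.commute)
  \<comment> \<open>Noise is exchanged for its mean only here, after integration; the saddle
    inequality is a statement about the mean field.\<close>
  finally have 1: "(\<Sum>s\<in>?I. \<gamma> s * (\<integral>\<omega>. drift s \<omega> \<partial>M)) \<le> R"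
    by (simp only: mean)
  have "(\<integral>\<omega>. low s \<omega> \<partial>M) \<le> (\<integral>\<omega>. drift s \<omega> \<partial>M)" for s
  proof (rule integral_mono[OF int_low int_drift])
    show "low s \<omega> \<le> drift s \<omega>" for \<omega>
      using saddle_gap[OF Z_Zset, of "g (X S k \<omega>)" i S k s \<omega>]
      by (simp add: low_def drift_def g_def dirn_def target_def)
  qed
  then have "(\<Sum>s\<in>?I. \<gamma> s * (\<integral>\<omega>. low s \<omega> \<partial>M)) \<le> (\<Sum>s\<in>?I. \<gamma> s * (\<integral>\<omega>. drift s \<omega> \<partial>M))"
    using \<gamma> by (intro sum_mono mult_left_mono) (auto simp: less_imp_le)
  with 1 have 2: "(\<Sum>s\<in>?I. \<gamma> s * (\<integral>\<omega>. low s \<omega> \<partial>M)) \<le> R"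
    by linarith
  \<comment> \<open>Everything is multiplied by the total weight \<open>?\<Gamma>\<close> to avoid
    divisions; the inequality combines \<open>descent_step\<close> with Jensen over the window, for
    each \<open>\<omega>\<close>.\<close>
  have point: "?\<Gamma> * (f i (X S (Suc k) \<omega>) - f i (X S k \<omega>)) + \<alpha> * ?\<Gamma> / 2 * (norm (dirn (X S k \<omega>)))\<^sup>2
      \<le> \<alpha> * (\<Sum>s\<in>?I. \<gamma> s * low s \<omega>)" for \<omega>
  proof -
    let ?w = "window_avg \<gamma> (P k) (S k) (\<lambda>s. fst (Z S k s \<omega>))"
    let ?gi = "grad (f i) (X S k \<omega>)"
    have "f i (X S (Suc k) \<omega>) - f i (X S k \<omega>) \<le> \<alpha> * (?gi \<bullet> ?w + (norm ?w)\<^sup>2 / 2)"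
      using descent_step[OF diff lip L \<alpha>, of i "X S k \<omega>" ?w] by (simp add: X_Suc P_def)
    then have "?\<Gamma> * (f i (X S (Suc k) \<omega>) - f i (X S k \<omega>)) \<le> ?\<Gamma> * (\<alpha> * (?gi \<bullet> ?w + (norm ?w)\<^sup>2 / 2))"
      using \<Gamma> by (intro mult_left_mono) auto
    also have "\<dots> = \<alpha> * (?\<Gamma> * (?gi \<bullet> ?w + (norm ?w)\<^sup>2 / 2))"
      by (simp only: mult.left_commute)
    also have "\<dots> \<le> \<alpha> * (\<Sum>s\<in>?I. \<gamma> s * (?gi \<bullet> fst (Z S k s \<omega>) + (norm (fst (Z S k s \<omega>)))\<^sup>2 / 2))"
      using \<alpha>(1) \<gamma> by (intro mult_left_mono window_avg_convex[OF \<Gamma>]) (auto simp: less_imp_le)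
    also have "(\<Sum>s\<in>?I. \<gamma> s * (?gi \<bullet> fst (Z S k s \<omega>) + (norm (fst (Z S k s \<omega>)))\<^sup>2 / 2))
        = (\<Sum>s\<in>?I. \<gamma> s * low s \<omega>) - ?\<Gamma> * ((norm (dirn (X S k \<omega>)))\<^sup>2 / 2)"
      unfolding low_def distrib_left sum.distrib sum_distrib_right by simp
    finally show ?thesis
      by (simp add: right_diff_distrib)
  qed
  have "?\<Gamma> * ((\<integral>\<omega>. f i (X S (Suc k) \<omega>) \<partial>M) - (\<integral>\<omega>. f i (X S k \<omega>) \<partial>M))
      + \<alpha> * ?\<Gamma> / 2 * (\<integral>\<omega>. (norm (dirn (X S k \<omega>)))\<^sup>2 \<partial>M)
    = (\<integral>\<omega>. ?\<Gamma> * (f i (X S (Suc k) \<omega>) - f i (X S k \<omega>)) + \<alpha> * ?\<Gamma> / 2 * (norm (dirn (X S k \<omega>)))\<^sup>2 \<partial>M)"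
    using int_f int_d by simp
  also have "\<dots> \<le> (\<integral>\<omega>. \<alpha> * (\<Sum>s\<in>?I. \<gamma> s * low s \<omega>) \<partial>M)"
    by (rule integral_mono[OF _ _ point]) (use int_f int_d int_low in simp_all)
  also have "\<dots> = \<alpha> * (\<Sum>s\<in>?I. \<gamma> s * (\<integral>\<omega>. low s \<omega> \<partial>M))"
    using int_low by simp
  also have "\<dots> \<le> \<alpha> * R"
    using 2 \<alpha>(1) by (intro mult_left_mono) auto
  finally have "?\<Gamma> * (\<alpha> / 2 * (\<integral>\<omega>. (norm (dirn (X S k \<omega>)))\<^sup>2 \<partial>M))
    \<le> ?\<Gamma> * ((\<integral>\<omega>. f i (X S k \<omega>) \<partial>M) - (\<integral>\<omega>. f i (X S (Suc k) \<omega>) \<partial>M) + \<alpha> * (R / ?\<Gamma>))"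
    using \<Gamma> by (simp add: algebra_simps)
  then show ?thesis
    using \<Gamma> unfolding R_def by (rule mult_left_le_imp_le)
qed

end

section \<open>Step-size sums and the rate in K\<close>

lemma inner_window_bounds:
  fixes \<gamma> :: "nat \<Rightarrow> real"
  assumes r: "0 < r" "r < 1" and S: "1 \<le> S" and c: "0 < c"
    and \<gamma>: "\<And>s. 1 \<le> s \<Longrightarrow> \<gamma> s = c / sqrt (real s)"
  shows "c * (1 - r) * sqrt (real S) \<le> (\<Sum>s=window_start r S..S. \<gamma> s)"
    and "(\<Sum>s=window_start r S..S. (\<gamma> s)\<^sup>2) \<le> c\<^sup>2 / r"
proof -
  let ?P = "window_start r S"
  have rS: "0 < r * real S" using r S by simp
  then have Plow: "r * real S \<le> real ?P" and Phigh: "real ?P \<le> r * real S + 1"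
    unfolding window_start_def by linarith+
  \<comment> \<open>The window avoids index 0, where the step is arbitrary; this also makes the
    number of its indices at most \<open>S\<close>.\<close>
  have P1: "1 \<le> ?P" using Plow rS by linarith
  have PS: "?P \<le> S"
    using r by (intro window_start_le_self) simp
  have card: "real (card {?P..S}) = real S + 1 - real ?P"
    using PS by simp
  have "c * (1 - r) * sqrt (real S) = (1 - r) * real S * (c / sqrt (real S))"
    using S by (simp add: real_div_sqrt field_simps)
  \<comment> \<open>The window has \<open>S + 1 - P\<close> indices and \<open>P\<close> is at most
    \<open>r * S + 1\<close>, so at least \<open>(1 - r) * S\<close> of them.\<close>
  also have "\<dots> \<le> real (card {?P..S}) * (c / sqrt (real S))"
    using Phigh c S unfolding card by (intro mult_right_mono) (auto simp: algebra_simps)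
  also have "\<dots> \<le> (\<Sum>s=?P..S. \<gamma> s)"
  proof (rule sum_bounded_below)
    fix s assume s: "s \<in> {?P..S}"
    then show "c / sqrt (real S) \<le> \<gamma> s"
      using P1 c by (subst \<gamma>) (auto intro!: divide_left_mono mult_pos_pos)
  qed
  finally show "c * (1 - r) * sqrt (real S) \<le> (\<Sum>s=?P..S. \<gamma> s)" .
  have "(\<Sum>s=?P..S. (\<gamma> s)\<^sup>2) \<le> real (card {?P..S}) * (c\<^sup>2 / (r * real S))"
  proof (rule sum_bounded_above)
    fix s assume s: "s \<in> {?P..S}"
    then have "(\<gamma> s)\<^sup>2 = c\<^sup>2 / real s"
      using P1 by (subst \<gamma>) (auto simp: power_divide)
    \<comment> \<open>On the window \<open>s\<close> is at least \<open>r * S\<close>, so the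
      squared steps are uniformly of order 1 / S and no harmonic sum appears.\<close>
    also have "\<dots> \<le> c\<^sup>2 / (r * real S)"
      using s P1 Plow rS by (intro divide_left_mono) auto
    finally show "(\<gamma> s)\<^sup>2 \<le> c\<^sup>2 / (r * real S)" .
  qed
  also have "\<dots> \<le> real S * (c\<^sup>2 / (r * real S))"
    using P1 r unfolding card by (intro mult_right_mono) auto
  also have "\<dots> = c\<^sup>2 / r"
    using S by simp
  finally show "(\<Sum>s=?P..S. (\<gamma> s)\<^sup>2) \<le> c\<^sup>2 / r" .
qed

text \<open>Far from the logarithmic truth, but after division by \<open>K\<close> it is exactly the
  rate required. Each summand is at most 1 over the square root of \<open>k + 1\<close>, which is
  bounded by the increment of twice the square root.\<close>

lemma sum_inverse_le_sqrt: "(\<Sum>k<K. 1 / real (k + 1)) \<le> 2 * sqrt (real K)"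
proof (induction K)
  case (Suc K)
  let ?a = "sqrt (real K)" and ?b = "sqrt (real (Suc K))"
  have b: "1 \<le> ?b" by simp
  have ab: "?a \<le> ?b" by simp
  have "(?b - ?a) * (?b + ?a) = 1"
    by (simp add: algebra_simps)
  then have "1 \<le> (?b - ?a) * (2 * ?b)"
    using ab by (metis add.commute add_left_mono diff_ge_0_iff_ge mult_2 mult_left_mono)
  then have "1 / ?b \<le> 2 * ?b - 2 * ?a"
    using b by (simp add: field_simps)
  moreover have "1 / real (K + 1) \<le> 1 / ?b"
  proof -
    have "?b * 1 \<le> ?b * ?b"
      using b by (intro mult_left_mono) auto
    then have "?b \<le> real (K + 1)" by simp
    then show ?thesis
      using b by (intro divide_left_mono) auto
  qed
  ultimately show ?case
    using Suc by simp
qed simp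

text \<open>The function values telescope over the outer iterations. In each error term the
  numerator is bounded independently of \<open>S k\<close>, while the total weight grows at least
  like its square root, hence like \<open>k + 1\<close>.\<close>

lemma (in msmd_run) avg_sq_dir_le:
  fixes i :: 'm and S :: "nat \<Rightarrow> nat"
  assumes \<gamma>_eq: "\<And>s. 1 \<le> s \<Longrightarrow> \<gamma> s = c / sqrt (real s)" and c: "0 < c"
    and K: "1 \<le> K" and S: "\<And>k. k < K \<Longrightarrow> (k + 1)\<^sup>2 \<le> S k" and B: "0 \<le> B"
    and orac: "\<And>k. k < K \<Longrightarrow> AE \<omega> in M. oracle_at f G Xi Cf \<delta> (X S k \<omega>)"
    and breg: "\<And>k. k < K \<Longrightarrow>
      AE \<omega> in M. \<forall>u\<in>Zset Cf. bregman Cf (Z S k (window_start r (S k)) \<omega>) u \<le> B"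
    and F: "F_inf \<le> (\<integral>\<omega>. f i (X S K \<omega>) \<partial>M)"
  shows "avg_sq_dir M f K (X S) \<le>
    (2 / \<alpha> * \<bar>f i x0 - F_inf\<bar> + 4 * ((B + noise_bound / (4 * \<kappa>) * (c\<^sup>2 / r)) / (c * (1 - r)))) / sqrt (real K)"
proof -
  define E where "E k = (\<integral>\<omega>. (norm (dirn (X S k \<omega>)))\<^sup>2 \<partial>M)" for k
  define R where "R = B + noise_bound / (4 * \<kappa>) * (c\<^sup>2 / r)"
  define C where "C = R / (c * (1 - r))"
  have Q: "0 \<le> noise_bound" by (simp add: noise_bound_def)
  have R: "0 \<le> R" unfolding R_def using Q B \<kappa>_pos r by simp
  have C: "0 \<le> C" unfolding C_def using R c r by simp
  have step: "\<alpha> / 2 * E k \<le> (\<integral>\<omega>. f i (X S k \<omega>) \<partial>M) - (\<integral>\<omega>. f i (X S (Suc k) \<omega>) \<partial>M)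
      + \<alpha> * (C * (1 / real (k + 1)))" if k: "k < K" for k
  proof -
    let ?I = "{window_start r (S k)..S k}"
    have Sk: "(real (k + 1))\<^sup>2 \<le> real (S k)"
      using S[OF k] by (metis of_nat_le_iff of_nat_power)
    have "(1::nat) \<le> (k + 1)\<^sup>2" by simp
    then have S1: "1 \<le> S k"
      using S[OF k] by linarith
    have sq: "real (k + 1) \<le> sqrt (real (S k))"
      using Sk by (rule real_le_rsqrt)
    note wb = inner_window_bounds[OF r S1 c \<gamma>_eq]
    have "(B + noise_bound / (4 * \<kappa>) * (\<Sum>s\<in>?I. (\<gamma> s)\<^sup>2)) / (\<Sum>s\<in>?I. \<gamma> s) \<le> R / (\<Sum>s\<in>?I. \<gamma> s)"
      unfolding R_def using Q \<kappa>_pos window_weight_pos[of "S k"]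
      by (intro divide_right_mono add_left_mono mult_left_mono wb(2)) auto
    also have "\<dots> \<le> R / (c * (1 - r) * sqrt (real (S k)))"
      using R c r S1 by (intro divide_left_mono wb(1) mult_pos_pos window_weight_pos) auto
    also have "\<dots> \<le> R / (c * (1 - r) * real (k + 1))"
      using R c r S1 by (intro divide_left_mono mult_left_mono sq mult_pos_pos) auto
    also have "\<dots> = C * (1 / real (k + 1))"
      by (simp add: C_def)
    finally have "\<alpha> * ((B + noise_bound / (4 * \<kappa>) * (\<Sum>s\<in>?I. (\<gamma> s)\<^sup>2)) / (\<Sum>s\<in>?I. \<gamma> s)) \<le> \<alpha> * (C * (1 / real (k + 1)))"
      using \<alpha>(1) by (intro mult_left_mono) auto
    then show ?thesis
      using outer_step[OF orac[OF k] breg[OF k], of i] unfolding E_def by linarith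
  qed
  have "\<alpha> / 2 * (\<Sum>k<K. E k) = (\<Sum>k<K. \<alpha> / 2 * E k)"
    by (rule sum_distrib_left)
  also have "\<dots> \<le> (\<Sum>k<K. (\<integral>\<omega>. f i (X S k \<omega>) \<partial>M) - (\<integral>\<omega>. f i (X S (Suc k) \<omega>) \<partial>M)
      + \<alpha> * (C * (1 / real (k + 1))))"
    using step by (intro sum_mono) simp
  also have "\<dots> = (\<integral>\<omega>. f i (X S 0 \<omega>) \<partial>M) - (\<integral>\<omega>. f i (X S K \<omega>) \<partial>M)
      + \<alpha> * (C * (\<Sum>k<K. 1 / real (k + 1)))"
    unfolding sum.distrib sum_distrib_left
    using sum_lessThan_telescope'[of "\<lambda>k. \<integral>\<omega>. f i (X S k \<omega>) \<partial>M" K] by simp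
  also have "(\<integral>\<omega>. f i (X S 0 \<omega>) \<partial>M) = f i x0"
    by (simp add: X_def prob_space)
  also have "f i x0 - (\<integral>\<omega>. f i (X S K \<omega>) \<partial>M) + \<alpha> * (C * (\<Sum>k<K. 1 / real (k + 1)))
      \<le> \<bar>f i x0 - F_inf\<bar> + \<alpha> * (C * (2 * sqrt (real K)))"
    using F \<alpha>(1) C by (intro add_mono mult_left_mono sum_inverse_le_sqrt) auto
  \<comment> \<open>The initial gap is constant in \<open>K\<close>, so multiplying it by the square
    root of \<open>K\<close> is harmless; the absolute value ensures that it is nonnegative.\<close>
  also have "\<dots> \<le> \<bar>f i x0 - F_inf\<bar> * sqrt (real K) + \<alpha> * (C * (2 * sqrt (real K)))"
    using K by (intro add_right_mono) (simp add: mult_le_cancel_left1)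
  \<comment> \<open>Pulling out \<open>\<alpha> / 2\<close> explains the constants:
    \<open>2 / \<alpha>\<close> on the gap, and 4 as the 2 of the harmonic bound doubled.\<close>
  also have "\<dots> = \<alpha> / 2 * ((2 / \<alpha> * \<bar>f i x0 - F_inf\<bar> + 4 * C) * sqrt (real K))"
    using \<alpha>(1) by (simp add: field_simps)
  finally have sum: "(\<Sum>k<K. E k) \<le> (2 / \<alpha> * \<bar>f i x0 - F_inf\<bar> + 4 * C) * sqrt (real K)"
    using \<alpha>(1) by (simp only: mult_le_cancel_left_pos[of "\<alpha> / 2"] half_gt_zero_iff)
  have "avg_sq_dir M f K (X S) = (1 / real K) * (\<Sum>k<K. E k)"
    by (simp add: avg_sq_dir_def E_def dirn_def steepest_dir_eq)
  also have "\<dots> \<le> (1 / real K) * ((2 / \<alpha> * \<bar>f i x0 - F_inf\<bar> + 4 * C) * sqrt (real K))"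
    using sum by (intro mult_left_mono) auto
  also have "\<dots> = (2 / \<alpha> * \<bar>f i x0 - F_inf\<bar> + 4 * C) * (sqrt (real K) / real K)"
    by simp
  also have "sqrt (real K) / real K = 1 / sqrt (real K)"
    using K by (simp add: divide_simps)
  finally show ?thesis
    by (simp add: C_def R_def)
qed

lemma M_star_pos: "2 \<le> m \<Longrightarrow> 0 < Cf \<Longrightarrow> 0 < M_star m Cf \<delta>"
  unfolding M_star_def by (intro real_sqrt_gt_zero add_pos_nonneg mult_pos_pos mult_nonneg_nonneg) (auto intro: add_pos_nonneg)

text \<open>The square-root term is at least 1 as the window starts no later than \<open>S\<close>,
  one of \<theta> and 1 / \<theta> is at least 1, and the term with \<open>D\<close> is
  nonnegative.\<close>

lemma M_two_ge:
  assumes "0 < \<theta>" "0 < Mstar" "0 < r" "r < 1" "1 \<le> S"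
  shows "2 * Mstar \<le> M_two D \<theta> Mstar r S"
proof -
  let ?P = "window_start r S"
  have PS: "?P \<le> S"
    using assms by (intro window_start_le_self) simp
  have P: "1 \<le> ?P"
    using assms by (simp add: window_start_def Suc_le_eq)
  have "1 \<le> sqrt (real S / real ?P)"
    using P PS by simp
  moreover have "0 \<le> 2 * D\<^sup>2 * real S / (real S - real ?P + 1)"
    using PS by (intro divide_nonneg_nonneg) auto
  ultimately have "2 * 1 \<le> (2 * D\<^sup>2 * real S / (real S - real ?P + 1) + 2 * sqrt (real S / real ?P)) * 1"
    unfolding mult_1_right by linarith
  moreover have "1 \<le> max \<theta> (1 / \<theta>)"
    using assms(1) by (auto simp: le_max_iff_disj)
  ultimately have "2 * 1 * Mstar \<le> (2 * D\<^sup>2 * real S / (real S - real ?P + 1)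
      + 2 * sqrt (real S / real ?P)) * max \<theta> (1 / \<theta>) * Mstar"
    using assms(2) by (intro mult_right_mono mult_mono) auto
  then show ?thesis
    by (simp add: M_two_def)
qed

theorem corollary4p2:
  fixes f :: "'m::finite \<Rightarrow> real^'n \<Rightarrow> real"
    and G :: "'m \<Rightarrow> real^'n \<Rightarrow> 'xi \<Rightarrow> real^'n"
    and M :: "'w measure" and Xi :: "'xi measure"
    and \<xi> :: "nat \<Rightarrow> nat \<Rightarrow> 'w \<Rightarrow> 'xi"
    and L F_inf Cf \<delta> \<theta> \<gamma>0 \<alpha> r :: real
    and x0 :: "real^'n"
    and U :: "((real^'n) \<times> (real^'m)) set"
    and Mstar D :: real and \<gamma> :: "nat \<Rightarrow> real"
    and X :: "(nat \<Rightarrow> nat) \<Rightarrow> nat \<Rightarrow> 'w \<Rightarrow> real^'n"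
  defines "Mstar \<equiv> M_star CARD('m) Cf \<delta>"
    and "\<gamma> \<equiv> inner_step \<theta> Mstar \<gamma>0"
    and "D \<equiv> Dbar Cf U"
    and "X \<equiv> \<lambda>S k \<omega>. msmd Cf \<gamma> (\<lambda>_. \<alpha>) r G x0 S (\<lambda>k s. \<xi> k s \<omega>) k"
  assumes "CARD('m) \<ge> 2"
    and "\<And>i x. f i differentiable (at x)"
    and "\<And>i. L-lipschitz_on UNIV (grad (f i))"
    and "L > 0"
    and "prob_space Xi"
    and "\<And>i. (\<lambda>(x, y). G i x y) \<in> borel_measurable (borel \<Otimes>\<^sub>M Xi)"
    and "prob_space M"
    and "prob_space.indep_vars M (\<lambda>_. Xi) (\<lambda>(k, s). \<xi> k s) UNIV"
    and "\<And>k s. distr M Xi (\<xi> k s) = Xi"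
    and "Cf > 0" and "\<delta> \<ge> 0" and "\<theta> > 0" and "\<gamma>0 > 0"
    and "0 < \<alpha>" and "\<alpha> \<le> 1 / (4 * L)"
    and "0 < r" and "r < 1"
    and "U \<subseteq> Zint Cf"
    and "\<And>u v. u \<in> U \<Longrightarrow> v \<in> Zset Cf \<Longrightarrow> bregman Cf u v \<le> D\<^sup>2 / 2"
  shows
    "(\<exists>c>0. \<forall>K\<ge>4. let S = (\<lambda>_. (K + 1)\<^sup>2) in
        run_assms M Xi f G F_inf Cf \<delta> K (X S) \<and> prox_centres_in U M Cf \<gamma> G S \<xi> K (X S) \<longrightarrow>
        avg_sq_dir M f K (X S)
          \<le> c * (4 * Cf * sqrt (M_two D \<theta> Mstar r ((K + 1)\<^sup>2)) * (1 / sqrt (real K))))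
   \<and> (\<exists>c>0. \<forall>K\<ge>4. let S = (\<lambda>k. (k + 1)\<^sup>2) in
        run_assms M Xi f G F_inf Cf \<delta> K (X S) \<and> prox_centres_in U M Cf \<gamma> G S \<xi> K (X S) \<longrightarrow>
        avg_sq_dir M f K (X S)
          \<le> c * (8 * Cf * sqrt (MAX k\<in>{..<K}. M_two D \<theta> Mstar r ((k + 1)\<^sup>2)) * (1 / sqrt (real K))))"
proof -
  have Mstar: "0 < Mstar"
    unfolding Mstar_def using assms(5,14) by (rule M_star_pos)
  have \<gamma>_pos: "0 < \<gamma> s" for s
    using Mstar \<open>\<theta> > 0\<close> \<open>\<gamma>0 > 0\<close> by (simp add: \<gamma>_def inner_step_def)
  interpret run: msmd_run M f G Xi \<xi> L Cf \<delta> \<alpha> r x0 \<gamma>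
    using assms(5-10,12-14,18-21) \<gamma>_pos \<open>prob_space M\<close>
    by (intro msmd_run.intro msmd_run_axioms.intro)
  have X: "X = run.X"
    by (rule ext)+ (simp add: X_def run.X_def)
  define c where "c = \<theta> / Mstar"
  have c: "0 < c"
    unfolding c_def using Mstar \<open>\<theta> > 0\<close> by simp
  have \<gamma>_eq: "\<gamma> s = c / sqrt (real s)" if "1 \<le> s" for s
    using that by (simp add: \<gamma>_def inner_step_def c_def)
  \<comment> \<open>The bound from any single objective already controls the common descent
    direction.\<close>
  obtain i :: 'm where True by simp
  \<comment> \<open>\<open>A\<close> involves neither \<open>K\<close> nor the schedule, as a
    constant chosen before \<open>K\<close> must.\<close>
  define A where "A = 2 / \<alpha> * \<bar>f i x0 - F_inf\<bar>
    + 4 * ((D\<^sup>2 / 2 + run.noise_bound / (4 * run.\<kappa>) * (c\<^sup>2 / r)) / (c * (1 - r)))"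
  have main: "avg_sq_dir M f K (X S) \<le> A / sqrt (real K)"
    if K: "4 \<le> K" and S: "\<And>k. k < K \<Longrightarrow> (k + 1)\<^sup>2 \<le> S k"
      and ra: "run_assms M Xi f G F_inf Cf \<delta> K (X S)"
      and pc: "prox_centres_in U M Cf \<gamma> G S \<xi> K (X S)" for K S
    unfolding A_def X
  proof (rule run.avg_sq_dir_le[OF \<gamma>_eq c _ S])
    fix k assume k: "k < K"
    show "AE \<omega> in M. oracle_at f G Xi Cf \<delta> (run.X S k \<omega>)"
      using ra k unfolding run_assms_def X by blast
    have "AE \<omega> in M. \<forall>s\<le>S k. run.Z S k s \<omega> \<in> U"
      using pc k unfolding prox_centres_in_def X run.Z_def by blast
    \<comment> \<open>The diameter bound is applied at the window start, an index at most
      \<open>S k\<close>, where \<open>prox_centres_in\<close> guarantees membership in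
      \<open>U\<close>.\<close>
    then show "AE \<omega> in M. \<forall>u\<in>Zset Cf. bregman Cf (run.Z S k (window_start r (S k)) \<omega>) u \<le> D\<^sup>2 / 2"
      by eventually_elim (use assms(23) run.window_start_le in blast)
  next
    show "F_inf \<le> (\<integral>\<omega>. f i (run.X S K \<omega>) \<partial>M)"
      using ra unfolding run_assms_def X by blast
  qed (use K in auto)
  \<comment> \<open>The denominator is a lower bound, uniform in \<open>K\<close>, for the factor
    multiplying 1 over the square root of \<open>K\<close>; the numerator is made positive so that
    \<open>C > 0\<close> whatever the sign of \<open>A\<close>.\<close>
  define C where "C = (\<bar>A\<bar> + 1) / (4 * Cf * sqrt (2 * Mstar))"
  have pos: "0 < 4 * Cf * sqrt (2 * Mstar)"
    using Mstar \<open>Cf > 0\<close> by simp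
  have ne: "4 * Cf * sqrt (2 * Mstar) \<noteq> 0"
    using less_imp_neq[OF pos] by (rule not_sym)
  have C: "0 < C"
    unfolding C_def using pos by (intro divide_pos_pos) auto
  have conv: "A / sqrt (real K) \<le> C * (b * Cf * sqrt T * (1 / sqrt (real K)))"
    if "4 \<le> b" "2 * Mstar \<le> T" for K b T
  proof -
    have "A \<le> \<bar>A\<bar> + 1" by simp
    also have "\<dots> = C * (4 * Cf * sqrt (2 * Mstar))"
      unfolding C_def by (simp only: times_divide_eq_left nonzero_mult_div_cancel_right[OF ne])
    also have "\<dots> \<le> C * (b * Cf * sqrt T)"
      using that C Mstar \<open>Cf > 0\<close> by (intro mult_left_mono mult_mono) auto
    finally have "A / sqrt (real K) \<le> C * (b * Cf * sqrt T) / sqrt (real K)"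
      by (rule divide_right_mono) simp
    then show ?thesis by simp
  qed
  have two: "2 * Mstar \<le> M_two D \<theta> Mstar r S" if "1 \<le> S" for S
    using \<open>\<theta> > 0\<close> Mstar \<open>0 < r\<close> \<open>r < 1\<close> that by (rule M_two_ge)
  show ?thesis
  proof (intro conjI exI[of _ C] allI impI C)
    fix K :: nat assume K: "4 \<le> K"
    show "let S = (\<lambda>_. (K + 1)\<^sup>2) in
        run_assms M Xi f G F_inf Cf \<delta> K (X S) \<and> prox_centres_in U M Cf \<gamma> G S \<xi> K (X S) \<longrightarrow>
        avg_sq_dir M f K (X S)
          \<le> C * (4 * Cf * sqrt (M_two D \<theta> Mstar r ((K + 1)\<^sup>2)) * (1 / sqrt (real K)))"
      unfolding Let_def
    proof (intro impI, elim conjE)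
      assume "run_assms M Xi f G F_inf Cf \<delta> K (X (\<lambda>_. (K + 1)\<^sup>2))"
        "prox_centres_in U M Cf \<gamma> G (\<lambda>_. (K + 1)\<^sup>2) \<xi> K (X (\<lambda>_. (K + 1)\<^sup>2))"
      then have "avg_sq_dir M f K (X (\<lambda>_. (K + 1)\<^sup>2)) \<le> A / sqrt (real K)"
        by (intro main K power_mono) auto
      also have "\<dots> \<le> C * (4 * Cf * sqrt (M_two D \<theta> Mstar r ((K + 1)\<^sup>2)) * (1 / sqrt (real K)))"
        by (rule conv[OF _ two]) simp_all
      finally show "avg_sq_dir M f K (X (\<lambda>_. (K + 1)\<^sup>2))
          \<le> C * (4 * Cf * sqrt (M_two D \<theta> Mstar r ((K + 1)\<^sup>2)) * (1 / sqrt (real K)))" .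
    qed
    show "let S = (\<lambda>k. (k + 1)\<^sup>2) in
        run_assms M Xi f G F_inf Cf \<delta> K (X S) \<and> prox_centres_in U M Cf \<gamma> G S \<xi> K (X S) \<longrightarrow>
        avg_sq_dir M f K (X S)
          \<le> C * (8 * Cf * sqrt (MAX k\<in>{..<K}. M_two D \<theta> Mstar r ((k + 1)\<^sup>2)) * (1 / sqrt (real K)))"
      unfolding Let_def
    proof (intro impI, elim conjE)
      assume "run_assms M Xi f G F_inf Cf \<delta> K (X (\<lambda>k. (k + 1)\<^sup>2))"
        "prox_centres_in U M Cf \<gamma> G (\<lambda>k. (k + 1)\<^sup>2) \<xi> K (X (\<lambda>k. (k + 1)\<^sup>2))"
      then have "avg_sq_dir M f K (X (\<lambda>k. (k + 1)\<^sup>2)) \<le> A / sqrt (real K)"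
        by (intro main K) auto
      also have "\<dots> \<le> C * (8 * Cf * sqrt (MAX k\<in>{..<K}. M_two D \<theta> Mstar r ((k + 1)\<^sup>2)) * (1 / sqrt (real K)))"
      proof (rule conv)
        have "2 * Mstar \<le> M_two D \<theta> Mstar r ((0 + 1)\<^sup>2)"
          by (rule two) simp
        \<comment> \<open>The term \<open>k = 0\<close> alone bounds the maximum from below, and it
          is present because \<open>K\<close> is positive.\<close>
        also have "\<dots> \<le> (MAX k\<in>{..<K}. M_two D \<theta> Mstar r ((k + 1)\<^sup>2))"
          by (intro Max_ge finite_imageI image_eqI[where x = 0]) (use K in auto)
        finally show "2 * Mstar \<le> (MAX k\<in>{..<K}. M_two D \<theta> Mstar r ((k + 1)\<^sup>2))" .
      qed simp
      finally show "avg_sq_dir M f K (X (\<lambda>k. (k + 1)\<^sup>2))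
          \<le> C * (8 * Cf * sqrt (MAX k\<in>{..<K}. M_two D \<theta> Mstar r ((k + 1)\<^sup>2)) * (1 / sqrt (real K)))" .
    qed
  qed
qed

end
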